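(* Let $d\ge1$, $r=2^d$, and identify the set of thieves with the vertex set $\{0,1\}^d$ of the $d$-dimensional cube. For any $n$ continuous probability measures $\mu_1,\dots,\mu_n$ on $[0,1]$ there exists a binary necklace splitting with $(r-1)n$ cuts, i.e. a fair partition/allocation $(x,f)$ with $N=(r-1)n$ cut points such that for each $i\in[N]$ either $f(i)=f(i+1)$ or $f(i)$ and $f(i+1)$ are adjacent vertices of the cube (differ in exactly one coordinate).
   Context: A partition/allocation with $N$ cut points is a pair $(x,f)$, $0=x_0\le x_1\le\dots\le x_N\le x_{N+1}=1$, with (possibly degenerate) intervals $I_j=[x_{j-1},x_j]$, $j\in[N+1]$, and an allocation function $f:[N+1]\to\{0,1\}^d$ assigning $I_j$ to thief $f(j)$. It is fair if for every $\kappa\in[n]$ and every thief $t$, $\mu_\kappa(\bigcup_{j\in f^{-1}(t)}I_j)=1/r$. *)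

theory Defs
  imports "HOL-Probability.Probability"
begin

text \<open>A continuous measure is read as an atomless one: singletons have measure 0 (absolute
  continuity with respect to Lebesgue measure is not required).\<close>

definition continuous_prob_measure :: "real measure \<Rightarrow> bool" where
  "continuous_prob_measure M \<longleftrightarrow>
     prob_space M \<and> sets M = sets (restrict_space borel {0..1}) \<and>
     (\<forall>x\<in>{0..1}. emeasure M {x} = 0)"

definition cube :: "nat \<Rightarrow> (nat \<Rightarrow> nat) set" where
  "cube d = {1..d} \<rightarrow>\<^sub>E {0, 1}"

definition cube_adjacent :: "nat \<Rightarrow> (nat \<Rightarrow> nat) \<Rightarrow> (nat \<Rightarrow> nat) \<Rightarrow> bool" where
  "cube_adjacent d u v \<longleftrightarrow>
     u \<in> cube d \<and> v \<in> cube d \<and> card {k \<in> {1..d}. u k \<noteq> v k} = 1"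

text \<open>The cut points \<open>x\<close> are indexed by \<open>0, \<dots>, N + 1\<close> and the pieces by \<open>1, \<dots>, N + 1\<close>;
  values of \<open>x\<close> and \<open>f\<close> at other indices are irrelevant.\<close>

definition piece :: "(nat \<Rightarrow> real) \<Rightarrow> nat \<Rightarrow> real set" where
  "piece x j = {x (j - 1)..x j}"

definition partition_allocation ::
  "nat \<Rightarrow> nat \<Rightarrow> (nat \<Rightarrow> real) \<Rightarrow> (nat \<Rightarrow> nat \<Rightarrow> nat) \<Rightarrow> bool" where
  "partition_allocation d N x f \<longleftrightarrow>
     x 0 = 0 \<and> x (N + 1) = 1 \<and> (\<forall>i\<in>{0..N}. x i \<le> x (i + 1)) \<and>
     f \<in> {1..N + 1} \<rightarrow> cube d"

definition fair ::
  "nat \<Rightarrow> nat \<Rightarrow> nat \<Rightarrow> (nat \<Rightarrow> real measure) \<Rightarrow> (nat \<Rightarrow> real) \<Rightarrow> (nat \<Rightarrow> nat \<Rightarrow> nat) \<Rightarrow> bool" where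
  "fair d n N \<mu> x f \<longleftrightarrow>
     (\<forall>\<kappa>\<in>{1..n}. \<forall>t\<in>cube d.
        measure (\<mu> \<kappa>) (\<Union>j\<in>{j \<in> {1..N + 1}. f j = t}. piece x j) = 1 / 2 ^ d)"

definition binary_necklace_splitting ::
  "nat \<Rightarrow> nat \<Rightarrow> nat \<Rightarrow> (nat \<Rightarrow> real measure) \<Rightarrow> (nat \<Rightarrow> real) \<Rightarrow> (nat \<Rightarrow> nat \<Rightarrow> nat) \<Rightarrow> bool" where
  "binary_necklace_splitting d n N \<mu> x f \<longleftrightarrow>
     partition_allocation d N x f \<and> fair d n N \<mu> x f \<and>
     (\<forall>i\<in>{1..N}. f i = f (i + 1) \<or> cube_adjacent d (f i) (f (i + 1)))"

end

(* Splitting among 2^d thieves reduces to repeated bisection. At stage c the step function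
   g : [0,1] -> {0,1}^d only uses the first c coordinates and each of the 2^c * n measures
   "mu_k restricted to {g = t}" has mass 1/2^c. The two-thief theorem bisects all of these
   simultaneously with 2^c * n cuts, at each of which only coordinate c + 1 flips; in total this
   takes (1 + 2 + ... + 2^(d-1)) * n cuts. Bisecting all restricted measures at once, by one
   function on [0,1], is what keeps neighbouring thieves adjacent in the cube.

   The two-thief theorem (Hobby-Rice) is obtained from its discrete version by placing beads at
   quantiles and passing to a limit. The discrete version follows from the octahedral Tucker
   lemma, which is proved by counting alternating flags modulo 2. *)

theory Submission
  imports Defs
begin

section \<open>The octahedral Tucker lemma\<close>

text \<open>Tucker's lemma bounds a number from below, whereas few cuts are wanted. Reversing the
  sign of every other bead resolves this: it turns \<open>c\<close> sign changes among
  \<open>N\<close> beads into \<open>N - 1 - c\<close>. If every balanced sign pattern had more than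
  \<open>n\<close> changes, then \<open>n\<close> absolute values for the colours and further ones
  for the numbers of changes after reversal would together stay below \<open>N\<close>, which the
  lemma forbids; this is how \<open>n\<close> measures come to need \<open>n\<close> cuts. The
  passage to the limit needs an error that does not grow with the number of beads. Mass minus
  weighted bead count is at most one bead weight at each bead, and summation by parts makes these
  discrepancies count only where the sign changes, hence at most \<open>n\<close> times. From the
  second stage on, the measures are restrictions of total mass below 1, and their distribution
  functions may be constant on intervals. The two-thief theorem is therefore stated for continuous
  nondecreasing functions of any total mass.\<close>

fun alternating :: "bool \<Rightarrow> bool list \<Rightarrow> bool" where
  "alternating s [] \<longleftrightarrow> True"
| "alternating s (x # xs) \<longleftrightarrow> x = s \<and> alternating (\<not> s) xs"

definition remove_nth :: "nat \<Rightarrow> 'a list \<Rightarrow> 'a list" where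
  "remove_nth i xs = take i xs @ drop (Suc i) xs"

lemma remove_nth_0 [simp]: "remove_nth 0 (x # xs) = xs"
  and remove_nth_Suc [simp]: "remove_nth (Suc i) (x # xs) = x # remove_nth i xs"
  by (simp_all add: remove_nth_def)

lemma map_remove_nth: "map f (remove_nth i xs) = remove_nth i (map f xs)"
  by (simp add: remove_nth_def take_map drop_map)

lemma alternating_unique: "alternating s xs \<Longrightarrow> alternating (\<not> s) xs \<Longrightarrow> xs = []"
  by (cases xs) auto

text \<open>A word that alternates has exactly one deletion alternating from \<open>s\<close>: the
  last letter if it starts with \<open>s\<close>, otherwise the first. In any other word there are
  two such deletions or none, since deleting either of two equal neighbours gives the same
  word.\<close>

lemma odd_sum_alternating_remove_nth:
  "xs \<noteq> [] \<Longrightarrow> odd (\<Sum>i<length xs. of_bool (alternating s (remove_nth i xs)) :: nat)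
     \<longleftrightarrow> alternating s xs \<or> alternating (\<not> s) xs"
proof (induction xs arbitrary: s)
  case Nil
  then show ?case by simp
next
  case (Cons x xs)
  have split: "(\<Sum>i<length (x # xs). of_bool (alternating s (remove_nth i (x # xs))) :: nat)
     = of_bool (alternating s xs)
       + (\<Sum>i<length xs. of_bool (x = s \<and> alternating (\<not> s) (remove_nth i xs)))"
    by (simp add: sum.lessThan_Suc_shift del: sum.lessThan_Suc)
  show ?case
  proof (cases "xs = []")
    case True
    then show ?thesis by (cases s; cases x) auto
  next
    case False
    then have excl: "\<not> (alternating s xs \<and> alternating (\<not> s) xs)"
      using alternating_unique by blast
    show ?thesis
    proof (cases "x = s")
      case True
      then show ?thesis
        unfolding split using Cons.IH[OF False, of "\<not> s"] excl by auto
    next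
      case neq: False
      then show ?thesis unfolding split by auto
    qed
  qed
qed

text \<open>When \<open>abs\<close> is injective on the set of labels, the sorted list is determined by the
  multiset. Sorting is only weak, but two equal labels would have equal signs.\<close>

definition alternating_labels :: "bool \<Rightarrow> int multiset \<Rightarrow> bool" where
  "alternating_labels s M \<longleftrightarrow>
     (\<exists>xs. mset xs = M \<and> sorted (map abs xs) \<and> alternating s (map (\<lambda>x. x > 0) xs))"

lemma alternating_labels_mset:
  assumes "sorted (map abs xs)" "inj_on abs (set xs)"
  shows "alternating_labels s (mset xs) \<longleftrightarrow> alternating s (map (\<lambda>x. x > 0) xs)"
proof
  assume "alternating_labels s (mset xs)"
  then obtain ys where ys: "mset ys = mset xs" "sorted (map abs ys)"
    "alternating s (map (\<lambda>x. x > 0) ys)"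
    by (auto simp: alternating_labels_def)
  have "sort_key abs xs = ys"
    using sort_key_inj_key_eq[of xs ys abs] ys assms by simp
  moreover have "sort_key abs xs = xs"
    using sort_key_inj_key_eq[of xs xs abs] assms by simp
  ultimately show "alternating s (map (\<lambda>x. x > 0) xs)" using ys by simp
qed (use assms in \<open>auto simp: alternating_labels_def\<close>)

text \<open>Sorting \<open>K\<close> by absolute label turns deletion of a vertex of the simplex
  \<open>K\<close> into deletion of a letter, where the count for words applies. \<open>f\<close>
  may repeat a label; injectivity of \<open>abs\<close> on the image rules out opposite
  labels.\<close>

lemma odd_card_alternating_facets:
  fixes f :: "'a \<Rightarrow> int"
  assumes "finite K" "K \<noteq> {}" "inj_on abs (f ` K)"
  shows "odd (card {k \<in> K. alternating_labels s (image_mset f (mset_set (K - {k})))})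
    \<longleftrightarrow> alternating_labels s (image_mset f (mset_set K))
      \<or> alternating_labels (\<not> s) (image_mset f (mset_set K))"
proof -
  obtain ks0 where "set ks0 = K" "distinct ks0"
    using assms(1) finite_distinct_list by blast
  then obtain ks where ks: "set ks = K" "distinct ks" "sorted (map (\<lambda>k. \<bar>f k\<bar>) ks)"
    by (intro that[of "sort_key (\<lambda>k. \<bar>f k\<bar>) ks0"]) auto
  define xs where "xs = map (\<lambda>x. x > 0) (map f ks)"
  have char: "alternating_labels t (image_mset f (mset_set (set ls)))
      \<longleftrightarrow> alternating t (map (\<lambda>x. x > 0) (map f ls))"
    if "distinct ls" "set ls \<subseteq> K" "sorted (map (\<lambda>k. \<bar>f k\<bar>) ls)" for ls t
  proof -
    have "inj_on abs (set (map f ls))"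
      using assms(3) that(2) by (metis image_mono inj_on_subset list.set_map)
    then show ?thesis
      using alternating_labels_mset[of "map f ls" t] that
      by (simp add: mset_set_set o_def)
  qed
  have rm: "alternating_labels s (image_mset f (mset_set (K - {ks ! i})))
      \<longleftrightarrow> alternating s (remove_nth i xs)" if i: "i < length ks" for i
  proof -
    have dec: "ks = take i ks @ ks ! i # drop (Suc i) ks"
      using i by (simp add: id_take_nth_drop)
    have "distinct (take i ks @ ks ! i # drop (Suc i) ks)" using ks(2) dec by simp
    moreover have "set (take i ks @ ks ! i # drop (Suc i) ks) = K" using ks(1) dec by simp
    ultimately have "set (remove_nth i ks) = K - {ks ! i}" "distinct (remove_nth i ks)"
      by (auto simp: remove_nth_def)
    moreover have "sorted (map (\<lambda>k. \<bar>f k\<bar>) (remove_nth i ks))"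
    proof -
      have "sorted (map (\<lambda>k. \<bar>f k\<bar>) (take i ks @ ks ! i # drop (Suc i) ks))"
        using ks(3) dec by simp
      then show ?thesis by (auto simp: remove_nth_def sorted_append)
    qed
    ultimately show ?thesis
      using char[of "remove_nth i ks" s] by (simp add: xs_def map_remove_nth)
  qed
  have inj: "inj_on (\<lambda>i. ks ! i) {..<length ks}"
    using ks(2) by (simp add: inj_on_nth)
  have "{k \<in> K. alternating_labels s (image_mset f (mset_set (K - {k})))}
      = (\<lambda>i. ks ! i) ` {i \<in> {..<length ks}. alternating s (remove_nth i xs)}"
  proof (intro equalityI subsetI)
    fix k assume k: "k \<in> {k \<in> K. alternating_labels s (image_mset f (mset_set (K - {k})))}"
    then obtain i where "i < length ks" "k = ks ! i" using ks(1) by (auto simp: in_set_conv_nth)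
    then show "k \<in> (\<lambda>i. ks ! i) ` {i \<in> {..<length ks}. alternating s (remove_nth i xs)}"
      using k rm by auto
  qed (use rm ks(1) in auto)
  then have "card {k \<in> K. alternating_labels s (image_mset f (mset_set (K - {k})))}
      = card {i \<in> {..<length ks}. alternating s (remove_nth i xs)}"
    by (simp only:) (intro card_image inj_on_subset[OF inj], auto)
  also have "\<dots> = (\<Sum>i<length xs. of_bool (alternating s (remove_nth i xs)))"
    by (simp add: xs_def Int_def)
  finally show ?thesis
    using odd_sum_alternating_remove_nth[of xs s] char[of ks s] char[of ks "\<not> s"] ks assms(2)
    by (auto simp: xs_def)
qed

text \<open>Negation keeps the order by absolute value and reverses each sign. A label 0 would spoil
  this, because it counts as negative before and after.\<close>

lemma alternating_labels_uminus:
  assumes "0 \<notin># M"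
  shows "alternating_labels s (image_mset uminus M) \<longleftrightarrow> alternating_labels (\<not> s) M"
proof -
  have imp: "alternating_labels (\<not> s) (image_mset uminus M)"
    if M: "0 \<notin># M" and alt: "alternating_labels s M" for s and M :: "int multiset"
  proof -
    obtain xs where xs: "mset xs = M" "sorted (map abs xs)" "alternating s (map (\<lambda>x. x > 0) xs)"
      using alt by (auto simp: alternating_labels_def)
    have "0 \<notin> set xs" using M xs(1) by auto
    then have "alternating s (map (\<lambda>x. x > 0) xs) \<Longrightarrow>
       alternating (\<not> s) (map (\<lambda>x. x > 0) (map uminus xs))" for s
      by (induction xs arbitrary: s) (simp_all, fastforce)
    with xs show ?thesis
      unfolding alternating_labels_def by (intro exI[of _ "map uminus xs"]) (auto simp: o_def)
  qed
  have "0 \<notin># image_mset uminus M" using assms by auto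
  from imp[OF this, of s] imp[OF assms, of "\<not> s"] show ?thesis
    by (auto simp: multiset.map_comp o_def)
qed

text \<open>Neighbours in the sorted word have opposite signs, hence are different, and injectivity
  of \<open>abs\<close> separates their absolute values. An alternating word thus uses as many
  absolute values as it has letters.\<close>

lemma alternating_imp_strict_sorted:
  assumes "sorted (map abs xs)" "inj_on abs (set xs)" "alternating s (map (\<lambda>x. x > 0) xs)"
  shows "sorted_wrt (<) (map abs (xs :: int list))"
  using assms
proof (induction xs arbitrary: s)
  case (Cons x xs)
  then have IH: "sorted_wrt (<) (map abs xs)" by auto
  show ?case
  proof (cases xs)
    case (Cons y ys)
    with Cons.prems have "x \<noteq> y" "\<bar>x\<bar> \<le> \<bar>y\<bar>" by auto
    with Cons.prems(2) Cons have "\<bar>x\<bar> < \<bar>y\<bar>" by (metis inj_on_eq_iff list.set_intros less_le)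
    with IH Cons show ?thesis by force
  qed auto
qed auto

lemma even_card_involution:
  assumes "finite S" "\<And>x. x \<in> S \<Longrightarrow> g x \<in> S" "\<And>x. x \<in> S \<Longrightarrow> g (g x) = x"
    "\<And>x. x \<in> S \<Longrightarrow> g x \<noteq> x"
  shows "even (card S)"
  using assms
proof (induction S rule: finite_psubset_induct)
  case (psubset S)
  show ?case
  proof (cases "S = {}")
    case False
    then obtain x where x: "x \<in> S" by auto
    let ?S = "S - {x, g x}"
    have "even (card ?S)"
    proof (rule psubset.IH)
      show "?S \<subset> S" using x by auto
      fix y assume y: "y \<in> ?S"
      then have "g y \<noteq> x" "g y \<noteq> g x"
        using psubset.prems(2) x by (metis Diff_iff insertI1 insertI2)+
      then show "g y \<in> ?S" using psubset.prems(1) y by auto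
    qed (use psubset.prems in auto)
    moreover have "card S = card ?S + 2"
    proof -
      have "card {x, g x} = 2" using psubset.prems(3)[OF x] by auto
      moreover have "{x, g x} \<subseteq> S" using x psubset.prems(1) by auto
      ultimately show ?thesis
        using psubset.hyps by (metis card_Diff_subset card_mono finite_subset le_add_diff_inverse2)
    qed
    ultimately show ?thesis by simp
  qed auto
qed

section \<open>Signed sets and their full flags\<close>

text \<open>A literal \<open>(k, b)\<close> puts sign \<open>b\<close> on coordinate
  \<open>k\<close>; injectivity of \<open>fst\<close> forbids both signs at once. The nonempty
  signed sets are the faces of the boundary of the \<open>N\<close>-dimensional cross-polytope, and
  \<open>neg_set\<close> is the antipodal map.\<close>

definition signed_set :: "nat \<Rightarrow> (nat \<times> bool) set \<Rightarrow> bool" where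
  "signed_set N X \<longleftrightarrow> X \<subseteq> {..<N} \<times> UNIV \<and> inj_on fst X"

abbreviation neg_set :: "(nat \<times> bool) set \<Rightarrow> (nat \<times> bool) set" where
  "neg_set X \<equiv> apsnd Not ` X"

text \<open>Full flags \<open>X\<^sub>1 \<subset> \<dots> \<subset> X\<^sub>j\<close> of signed sets on \<open>{..<j}\<close> are encoded by the lists of
  the literals in the order in which they appear.\<close>

definition flags :: "nat \<Rightarrow> (nat \<times> bool) list set" where
  "flags j = {l. distinct (map fst l) \<and> set (map fst l) = {..<j}}"

abbreviation flag_member :: "(nat \<times> bool) list \<Rightarrow> nat \<Rightarrow> (nat \<times> bool) set" where
  "flag_member l k \<equiv> set (take (Suc k) l)"

lemma length_flags: "l \<in> flags j \<Longrightarrow> length l = j"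
  unfolding flags_def using distinct_card[of "map fst l"] by simp

lemma flags_subset:
  assumes "l \<in> flags j" shows "set l \<subseteq> {..<j} \<times> UNIV"
proof -
  have "fst ` set l = {..<j}" using assms by (simp add: flags_def)
  then have "fst x < j" if "x \<in> set l" for x using that by (metis image_eqI lessThan_iff)
  then show ?thesis by auto
qed

lemma flags_0 [simp]: "flags 0 = {[]}"
  by (auto simp: flags_def)

lemma finite_flags: "finite (flags j)"
proof (rule finite_subset)
  show "flags j \<subseteq> {l. set l \<subseteq> {..<j} \<times> UNIV \<and> length l = j}"
    using length_flags flags_subset by blast
qed (auto intro: finite_lists_length_eq)

lemma flags_snocI: "l \<in> flags j \<Longrightarrow> l @ [(j, b)] \<in> flags (Suc j)"
  by (auto simp: flags_def)

lemma flags_snocD: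
  assumes "l @ [(j, b)] \<in> flags (Suc j)" shows "l \<in> flags j"
proof -
  have "distinct (map fst l)" "j \<notin> fst ` set l" "insert j (fst ` set l) = {..<Suc j}"
    using assms by (auto simp: flags_def)
  moreover from this have "fst ` set l = {..<Suc j} - {j}"
    by (metis Diff_insert_absorb)
  then have "fst ` set l = {..<j}" by auto
  ultimately show ?thesis by (simp add: flags_def)
qed

text \<open>Crosses the facet that omits member \<open>i\<close>. Exchanging the literals
  \<open>i\<close> and \<open>Suc i\<close> changes no other member. The last literal has no
  successor to exchange with, and the only other flag through that facet has its sign
  reversed.\<close>

definition flag_swap :: "nat \<Rightarrow> (nat \<times> bool) list \<Rightarrow> (nat \<times> bool) list" where
  "flag_swap i l = (if Suc i < length l then l[i := l ! Suc i, Suc i := l ! i]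
     else l[i := apsnd Not (l ! i)])"

lemma flag_swap_in_flags:
  assumes "l \<in> flags j" "i < j" shows "flag_swap i l \<in> flags j"
proof (cases "Suc i < length l")
  case True
  then have eq: "map fst (flag_swap i l) = (map fst l)[i := map fst l ! Suc i, Suc i := map fst l ! i]"
    by (simp add: flag_swap_def map_update)
  have "i < length (map fst l)" "Suc i < length (map fst l)" using True by auto
  from set_swap[OF this] distinct_swap[OF this] assms(1) show ?thesis
    unfolding flags_def mem_Collect_eq eq by simp
next
  case False
  then have "map fst (flag_swap i l) = (map fst l)[i := map fst l ! i]"
    using assms length_flags[OF assms(1)] by (simp add: flag_swap_def map_update)
  then have "map fst (flag_swap i l) = map fst l" by (simp only: list_update_id)
  with assms show ?thesis unfolding flags_def by (simp only: mem_Collect_eq)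
qed

lemma flag_swap_swap:
  assumes "i < length l" shows "flag_swap i (flag_swap i l) = l"
  using assms
  by (cases "l ! i") (auto simp: flag_swap_def list_eq_iff_nth_eq nth_list_update)

lemma flag_swap_neq:
  assumes "l \<in> flags j" "i < j" shows "flag_swap i l \<noteq> l"
proof
  assume eq: "flag_swap i l = l"
  have len: "length l = j" using assms length_flags by blast
  show False
  proof (cases "Suc i < length l")
    case True
    then have "flag_swap i l ! i = l ! Suc i" by (simp add: flag_swap_def)
    then have "map fst l ! i = map fst l ! Suc i" using eq True by simp
    moreover have "distinct (map fst l)" using assms by (simp add: flags_def)
    ultimately show False using True by (metis Suc_lessD length_map n_not_Suc_n nth_eq_iff_index_eq)
  next
    case False
    then have "flag_swap i l ! i = apsnd Not (l ! i)" using len assms by (simp add: flag_swap_def)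
    then show False using eq by (cases "l ! i") simp
  qed
qed

text \<open>A prefix other than the one of length \<open>Suc i\<close> contains both of the
  exchanged literals or neither of them; if the last literal is reversed, all remaining prefixes are
  too short to contain it.\<close>

lemma flag_member_swap:
  assumes "k < length l" "i < length l" "k \<noteq> i"
  shows "flag_member (flag_swap i l) k = flag_member l k"
proof (cases "k < i")
  case True
  then show ?thesis by (simp add: flag_swap_def)
next
  case False
  then have "Suc i < length l" "i < Suc k" "Suc i < Suc k" using assms by auto
  then have "take (Suc k) (flag_swap i l)
      = (take (Suc k) l)[i := take (Suc k) l ! Suc i, Suc i := take (Suc k) l ! i]"
    by (simp add: flag_swap_def take_update_swap)
  moreover have "i < length (take (Suc k) l)" "Suc i < length (take (Suc k) l)"
    using \<open>Suc i < length l\<close> \<open>Suc i < Suc k\<close> by auto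
  ultimately show ?thesis by (metis set_swap)
qed

section \<open>Parity of the number of alternating flags\<close>

locale tucker_labelling =
  fixes N :: nat and lam :: "(nat \<times> bool) set \<Rightarrow> int"
  assumes antipodal: "\<And>X. signed_set N X \<Longrightarrow> X \<noteq> {} \<Longrightarrow> lam (neg_set X) = - lam X"
    and nonzero: "\<And>X. signed_set N X \<Longrightarrow> X \<noteq> {} \<Longrightarrow> lam X \<noteq> 0"
    and no_complementary: "\<And>X Y. signed_set N X \<Longrightarrow> signed_set N Y \<Longrightarrow> X \<noteq> {} \<Longrightarrow> X \<subseteq> Y \<Longrightarrow>
      lam Y \<noteq> - lam X"
begin

definition labels :: "nat set \<Rightarrow> (nat \<times> bool) list \<Rightarrow> int multiset" where
  "labels K l = image_mset (\<lambda>k. lam (flag_member l k)) (mset_set K)"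

lemma flag_member:
  assumes "l \<in> flags j" "j \<le> N" "k < j"
  shows "signed_set N (flag_member l k)" "flag_member l k \<noteq> {}"
proof -
  have sub: "flag_member l k \<subseteq> set l" by (rule set_take_subset)
  have "inj_on fst (set l)" using assms(1) by (simp add: flags_def distinct_map)
  moreover have "set l \<subseteq> {..<N} \<times> UNIV" using flags_subset[OF assms(1)] assms(2) by auto
  ultimately show "signed_set N (flag_member l k)"
    unfolding signed_set_def using sub by (blast intro: inj_on_subset)
  show "flag_member l k \<noteq> {}" using assms length_flags[OF assms(1)] by auto
qed

text \<open>Members of a flag are nested, so \<open>no_complementary\<close> excludes opposite
  labels, and equal absolute values leave only equal labels.\<close>

lemma inj_on_abs_labels:
  assumes "l \<in> flags j" "j \<le> N" "K \<subseteq> {..<j}"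
  shows "inj_on abs ((\<lambda>k. lam (flag_member l k)) ` K)"
proof -
  have "lam (flag_member l a) = lam (flag_member l b)"
    if "a \<le> b" "b < j" "\<bar>lam (flag_member l a)\<bar> = \<bar>lam (flag_member l b)\<bar>" for a b
  proof -
    have "flag_member l a \<subseteq> flag_member l b" using that(1) by (simp add: set_take_subset_set_take)
    then have "lam (flag_member l b) \<noteq> - lam (flag_member l a)"
      using that flag_member[OF assms(1,2)] by (intro no_complementary) auto
    with that(3) show ?thesis by linarith
  qed
  note le = this
  show ?thesis
  proof (rule inj_onI, elim imageE)
    fix x y a b assume *: "\<bar>x\<bar> = \<bar>y\<bar>" "x = lam (flag_member l a)" "y = lam (flag_member l b)"
      "a \<in> K" "b \<in> K"
    then have "a < j" "b < j" using assms(3) by auto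
    consider "a \<le> b" | "b \<le> a" by linarith
    then have "lam (flag_member l a) = lam (flag_member l b)"
    proof cases
      case 1
      show ?thesis using le[OF 1 \<open>b < j\<close>] * by metis
    next
      case 2
      show ?thesis using le[OF 2 \<open>a < j\<close>] * by metis
    qed
    with *(2,3) show "x = y" by simp
  qed
qed

lemma labels_neg:
  assumes "l \<in> flags j" "j \<le> N"
  shows "labels {..<j} (map (apsnd Not) l) = image_mset uminus (labels {..<j} l)"
proof -
  have "lam (flag_member (map (apsnd Not) l) k) = - lam (flag_member l k)" if "k < j" for k
    using flag_member[OF assms that] antipodal by (simp add: take_map)
  then show ?thesis
    by (auto simp: labels_def multiset.map_comp intro!: image_mset_cong)
qed

lemma zero_notin_labels: "l \<in> flags j \<Longrightarrow> j \<le> N \<Longrightarrow> 0 \<notin># labels {..<j} l"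
  using flag_member nonzero by (auto simp: labels_def)

definition alternating_flags :: "nat \<Rightarrow> (nat \<times> bool) list set" where
  "alternating_flags j = {l \<in> flags j. alternating_labels True (labels {..<j} l)}"

lemma odd_facets:
  assumes "l \<in> flags (Suc j)" "Suc j \<le> N"
  shows "odd (card {i \<in> {..<Suc j}. alternating_labels True (labels ({..<Suc j} - {i}) l)})
    \<longleftrightarrow> alternating_labels True (labels {..<Suc j} l)
      \<or> alternating_labels False (labels {..<Suc j} l)"
  unfolding labels_def
  using odd_card_alternating_facets[of "{..<Suc j}" "\<lambda>k. lam (flag_member l k)" True]
    inj_on_abs_labels[OF assms order.refl] by auto

lemma not_both_alternating:
  assumes "l \<in> flags (Suc j)" "Suc j \<le> N"
  shows "\<not> (alternating_labels True (labels {..<Suc j} l)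
    \<and> alternating_labels False (labels {..<Suc j} l))"
proof
  assume both: "alternating_labels True (labels {..<Suc j} l)
    \<and> alternating_labels False (labels {..<Suc j} l)"
  then obtain xs where xs: "mset xs = labels {..<Suc j} l" "sorted (map abs xs)"
    by (auto simp: alternating_labels_def)
  have "set xs = (\<lambda>k. lam (flag_member l k)) ` {..<Suc j}"
    using arg_cong[OF xs(1), of set_mset] by (simp add: labels_def)
  then have "inj_on abs (set xs)" using inj_on_abs_labels[OF assms order.refl] by simp
  from alternating_labels_mset[OF xs(2) this] both xs(1) have "map (\<lambda>x. x > 0) xs = []"
    using alternating_unique[of True "map (\<lambda>x. x > 0) xs"] by auto
  then have "xs = []" by simp
  with \<open>set xs = _\<close> show False by auto
qed

text \<open>These flags subdivide the closed hemisphere where coordinate \<open>j\<close> is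
  positive or zero; its equator carries the flags of \<open>flags j\<close>.\<close>

definition upper_flags :: "nat \<Rightarrow> (nat \<times> bool) list set" where
  "upper_flags j = {l \<in> flags (Suc j). (j, True) \<in> set l}"

lemma map_neg_in_flags: "map (apsnd Not) l \<in> flags j \<longleftrightarrow> l \<in> flags j"
  by (simp add: flags_def o_def image_image)

lemma apsnd_Not_Not [simp]: "apsnd Not (apsnd Not x) = x"
  by (cases x) simp

lemma flag_literal:
  assumes "l \<in> flags (Suc j)"
  shows "(j, False) \<in> set l \<longleftrightarrow> (j, True) \<notin> set l"
proof -
  have "inj_on fst (set l)" "fst ` set l = {..<Suc j}"
    using assms by (auto simp: flags_def distinct_map)
  moreover have "j \<in> fst ` set l" using calculation(2) by simp
  then obtain b where "(j, b) \<in> set l" by auto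
  then have "(j, False) \<in> set l \<or> (j, True) \<in> set l" by (cases b) auto
  ultimately show ?thesis using inj_onD[of fst "set l" "(j, False)" "(j, True)"] by auto
qed

text \<open>The antipodal map moves the alternating flags of the lower hemisphere to the upper one,
  where their labels start with the opposite sign. Since no flag alternates in both ways, nothing is
  counted twice.\<close>

lemma card_alternating_flags_Suc:
  assumes "Suc j \<le> N"
  shows "card (alternating_flags (Suc j)) = card {l \<in> upper_flags j.
    alternating_labels True (labels {..<Suc j} l) \<or> alternating_labels False (labels {..<Suc j} l)}"
proof -
  let ?A = "\<lambda>s l. alternating_labels s (labels {..<Suc j} l)"
  have fin: "finite {l \<in> flags (Suc j). P l}" for P using finite_flags by auto
  have neg: "bij_betw (map (apsnd Not)) {l \<in> flags (Suc j). (j, True) \<notin> set l \<and> ?A True l}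
      {l \<in> flags (Suc j). (j, True) \<in> set l \<and> ?A False l}"
  proof (rule bij_betw_byWitness[where f' = "map (apsnd Not)"])
    have lit: "(j, True) \<in> apsnd Not ` set l \<longleftrightarrow> (j, True) \<notin> set l" if "l \<in> flags (Suc j)" for l
    proof -
      have "(j, True) \<in> apsnd Not ` set l \<longleftrightarrow> (j, False) \<in> set l"
        by (force simp: image_iff)
      with flag_literal[OF that] show ?thesis by simp
    qed
    have alt: "?A s (map (apsnd Not) l) \<longleftrightarrow> ?A (\<not> s) l" if "l \<in> flags (Suc j)" for s l
      using labels_neg[OF that assms] zero_notin_labels[OF that assms]
      by (simp add: alternating_labels_uminus)
    show "map (apsnd Not) ` {l \<in> flags (Suc j). (j, True) \<notin> set l \<and> ?A True l}
        \<subseteq> {l \<in> flags (Suc j). (j, True) \<in> set l \<and> ?A False l}"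
      using lit alt map_neg_in_flags by auto
    show "map (apsnd Not) ` {l \<in> flags (Suc j). (j, True) \<in> set l \<and> ?A False l}
        \<subseteq> {l \<in> flags (Suc j). (j, True) \<notin> set l \<and> ?A True l}"
      using lit alt map_neg_in_flags by auto
  qed (auto simp: o_def)
  have "alternating_flags (Suc j) = {l \<in> flags (Suc j). (j, True) \<in> set l \<and> ?A True l}
      \<union> {l \<in> flags (Suc j). (j, True) \<notin> set l \<and> ?A True l}"
    by (auto simp: alternating_flags_def)
  then have "card (alternating_flags (Suc j))
      = card {l \<in> flags (Suc j). (j, True) \<in> set l \<and> ?A True l}
        + card {l \<in> flags (Suc j). (j, True) \<notin> set l \<and> ?A True l}"
    by (simp only:) (intro card_Un_disjoint fin, auto)
  also have "\<dots> = card {l \<in> flags (Suc j). (j, True) \<in> set l \<and> ?A True l}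
        + card {l \<in> flags (Suc j). (j, True) \<in> set l \<and> ?A False l}"
    using bij_betw_same_card[OF neg] by simp
  also have "\<dots> = card ({l \<in> flags (Suc j). (j, True) \<in> set l \<and> ?A True l}
        \<union> {l \<in> flags (Suc j). (j, True) \<in> set l \<and> ?A False l})"
    using not_both_alternating[OF _ assms]
    by (intro card_Un_disjoint[symmetric] fin) blast
  also have "{l \<in> flags (Suc j). (j, True) \<in> set l \<and> ?A True l}
        \<union> {l \<in> flags (Suc j). (j, True) \<in> set l \<and> ?A False l}
      = {l \<in> upper_flags j. ?A True l \<or> ?A False l}"
    by (auto simp: upper_flags_def)
  finally show ?thesis .
qed

text \<open>Double counting of pairs of a flag in the upper hemisphere and an alternating facet of it.
  Every facet lies in exactly two flags, except for the facets in the equator.\<close>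

lemma odd_alternating_flags_Suc:
  assumes "Suc j \<le> N"
  shows "odd (card (alternating_flags (Suc j))) \<longleftrightarrow> odd (card (alternating_flags j))"
proof -
  define P where "P l i \<longleftrightarrow> alternating_labels True (labels ({..<Suc j} - {i}) l)" for l i
  define S where "S = (SIGMA l : upper_flags j. {i \<in> {..<Suc j}. P l i})"
  \<comment> \<open>Equatorial pairs: the omitted member is the top one and the last literal is
    \<open>(j, True)\<close>, so the remaining members use only coordinates below \<open>j\<close>.
    Crossing such a facet would leave the hemisphere.\<close>
  define S1 where "S1 = {(l, i) \<in> S. i = j \<and> l ! j = (j, True)}"
  have fin_upper: "finite (upper_flags j)" unfolding upper_flags_def using finite_flags by auto
  then have fin: "finite S" unfolding S_def by auto
  have "even (card (S - S1))"
  proof (rule even_card_involution[where g = "\<lambda>(l, i). (flag_swap i l, i)"])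
    fix x assume x: "x \<in> S - S1"
    obtain l i where li: "x = (l, i)" by (cases x)
    have l: "l \<in> flags (Suc j)" "(j, True) \<in> set l" "i < Suc j" "P l i"
      using x li by (auto simp: S_def upper_flags_def)
    have len: "length l = Suc j" using l length_flags by blast
    have sw: "flag_swap i l \<in> flags (Suc j)" using l flag_swap_in_flags by blast
    have "labels ({..<Suc j} - {i}) (flag_swap i l) = labels ({..<Suc j} - {i}) l"
      unfolding labels_def using len l by (intro image_mset_cong) (simp add: flag_member_swap)
    then have P: "P (flag_swap i l) i" using l by (simp add: P_def)
    \<comment> \<open>If the top member is omitted and the last literal is not
      \<open>(j, True)\<close>, that literal belongs to another coordinate; reversing it keeps
      \<open>(j, True)\<close> in the flag and the pair outside \<open>S1\<close>.\<close>
    have mem: "(j, True) \<in> set (flag_swap i l) \<and> (i = j \<longrightarrow> flag_swap i l ! j \<noteq> (j, True))"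
    proof (cases "i < j")
      case True
      then show ?thesis using l len by (simp add: flag_swap_def set_swap)
    next
      case False
      then have i: "i = j" using l by auto
      have fs: "flag_swap i l = l[j := apsnd Not (l ! j)]" using i len by (simp add: flag_swap_def)
      have nT: "l ! j \<noteq> (j, True)" using x li i by (auto simp: S1_def)
      have nF: "l ! j \<noteq> (j, False)"
        using flag_literal[OF l(1)] l(2) len by (metis lessI nth_mem)
      obtain p where "p < Suc j" "l ! p = (j, True)" using l(2) len by (auto simp: in_set_conv_nth)
      moreover from this nT have "p \<noteq> j" by auto
      ultimately have "l[j := apsnd Not (l ! j)] ! p = (j, True)" by simp
      then have "(j, True) \<in> set (l[j := apsnd Not (l ! j)])"
        using \<open>p < Suc j\<close> len by (metis length_list_update nth_mem)
      moreover have "l[j := apsnd Not (l ! j)] ! j \<noteq> (j, True)"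
        using nF len by (cases "l ! j") auto
      ultimately show ?thesis using fs i by metis
    qed
    show "(case x of (l, i) \<Rightarrow> (flag_swap i l, i)) \<in> S - S1"
      using l sw P mem li by (auto simp: S_def S1_def upper_flags_def)
    show "(case case x of (l, i) \<Rightarrow> (flag_swap i l, i) of (l, i) \<Rightarrow> (flag_swap i l, i)) = x"
      using li len l(3) by (simp add: flag_swap_swap)
    show "(case x of (l, i) \<Rightarrow> (flag_swap i l, i)) \<noteq> x"
      using li l flag_swap_neq by auto
  qed (use fin in auto)
  moreover have "card S = card (S - S1) + card S1"
  proof -
    have "S1 \<subseteq> S" by (auto simp: S1_def)
    then show ?thesis using fin by (metis card_Diff_subset card_mono finite_subset le_add_diff_inverse2)
  qed
  moreover have "bij_betw (\<lambda>l. (l @ [(j, True)], j)) (alternating_flags j) S1"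
  proof (rule bij_betw_imageI)
    have lab: "P (l @ [(j, True)]) j \<longleftrightarrow> alternating_labels True (labels {..<j} l)"
      if "l \<in> flags j" for l
    proof -
      have "{..<Suc j} - {j} = {..<j}" by auto
      moreover have "labels {..<j} (l @ [(j, True)]) = labels {..<j} l"
        unfolding labels_def using length_flags[OF that] by (intro image_mset_cong) simp
      ultimately show ?thesis by (simp add: P_def)
    qed
    show "(\<lambda>l. (l @ [(j, True)], j)) ` alternating_flags j = S1"
    proof (intro equalityI subsetI)
      fix x assume "x \<in> (\<lambda>l. (l @ [(j, True)], j)) ` alternating_flags j"
      then obtain l where "x = (l @ [(j, True)], j)" "l \<in> flags j"
        "alternating_labels True (labels {..<j} l)" by (auto simp: alternating_flags_def)
      with lab[of l] flags_snocI[of l j True] length_flags[of l j] show "x \<in> S1"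
        by (auto simp: S1_def S_def upper_flags_def nth_append)
    next
      fix x assume "x \<in> S1"
      then obtain l where l: "x = (l, j)" "l \<in> flags (Suc j)" "l ! j = (j, True)" "P l j"
        by (auto simp: S1_def S_def upper_flags_def)
      have "length l = Suc j" using l length_flags by blast
      then have "l = butlast l @ [(j, True)]"
        using l(3) by (metis append_butlast_last_id diff_Suc_1 last_conv_nth length_0_conv nat.distinct(1))
      then obtain l' where l': "l = l' @ [(j, True)]" by blast
      have "l' \<in> flags j" using l l' flags_snocD by blast
      with l l' lab[of l'] show "x \<in> (\<lambda>l. (l @ [(j, True)], j)) ` alternating_flags j"
        by (auto simp: alternating_flags_def)
    qed
  qed (auto simp: inj_on_def)
  then have "card S1 = card (alternating_flags j)" by (simp add: bij_betw_same_card)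
  \<comment> \<open>Counted by flags, the parity of \<open>S\<close> is that of the number of flags
    with an odd number of alternating facets; by \<open>odd_facets\<close> these are the flags whose
    labels alternate with either first sign.\<close>
  moreover have "card S = (\<Sum>l\<in>upper_flags j. card {i \<in> {..<Suc j}. P l i})"
    unfolding S_def using fin_upper by (intro card_SigmaI) auto
  moreover have "even (\<Sum>l\<in>upper_flags j. card {i \<in> {..<Suc j}. P l i})
      \<longleftrightarrow> even (card {l \<in> upper_flags j. odd (card {i \<in> {..<Suc j}. P l i})})"
    using fin_upper by (rule even_sum_iff)
  moreover have "{l \<in> upper_flags j. odd (card {i \<in> {..<Suc j}. P l i})} = {l \<in> upper_flags j.
    alternating_labels True (labels {..<Suc j} l) \<or> alternating_labels False (labels {..<Suc j} l)}"
    using odd_facets[OF _ assms] by (auto simp: upper_flags_def P_def)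
  ultimately show ?thesis using card_alternating_flags_Suc[OF assms] by simp
qed

lemma odd_alternating_flags: "j \<le> N \<Longrightarrow> odd (card (alternating_flags j))"
proof (induction j)
  case 0
  have "alternating_flags 0 = {[]}"
    by (auto simp: alternating_flags_def labels_def alternating_labels_def)
  then show ?case by simp
qed (use odd_alternating_flags_Suc in auto)

text \<open>Some flag is alternating, and its \<open>N\<close> labels have \<open>N\<close>
  different absolute values. None of them is 0, so they do not all fit below
  \<open>N\<close>.\<close>

lemma large_label: "\<exists>X. signed_set N X \<and> X \<noteq> {} \<and> \<bar>lam X\<bar> \<ge> int N" if "N > 0"
proof (rule ccontr)
  assume "\<not> ?thesis"
  then have small: "\<bar>lam X\<bar> < int N" if "signed_set N X" "X \<noteq> {}" for X
    using that not_le by blast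
  have "alternating_flags N \<noteq> {}" using odd_alternating_flags[of N] by auto
  then obtain l where l: "l \<in> flags N" "alternating_labels True (labels {..<N} l)"
    by (auto simp: alternating_flags_def)
  then obtain xs where xs: "mset xs = labels {..<N} l" "sorted (map abs xs)"
    "alternating True (map (\<lambda>x. x > 0) xs)"
    by (auto simp: alternating_labels_def)
  have set_xs: "set xs = (\<lambda>k. lam (flag_member l k)) ` {..<N}"
    using arg_cong[OF xs(1), of set_mset] by (simp add: labels_def)
  then have "inj_on abs (set xs)" using inj_on_abs_labels[OF l(1) order.refl order.refl] by simp
  from alternating_imp_strict_sorted[OF xs(2) this xs(3)] have dist: "distinct (map abs xs)"
    using strict_sorted_iff by blast
  have "set (map abs xs) \<subseteq> {1..int N - 1}"
  proof
    fix a assume "a \<in> set (map abs xs)"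
    then obtain k where k: "k < N" "a = \<bar>lam (flag_member l k)\<bar>" using set_xs by auto
    show "a \<in> {1..int N - 1}"
      using flag_member[OF l(1) order.refl k(1)] nonzero[of "flag_member l k"]
        small[of "flag_member l k"] k(2) by auto
  qed
  from card_mono[OF _ this] have "card (set (map abs xs)) \<le> N - 1" by auto
  moreover have "card (set (map abs xs)) = N"
    using distinct_card[OF dist] arg_cong[OF xs(1), of size] by (simp add: labels_def)
  ultimately show False using that by simp
qed

end

section \<open>Discrete necklaces with two thieves\<close>

definition changes :: "nat \<Rightarrow> (nat \<Rightarrow> bool) \<Rightarrow> nat" where
  "changes N t = card {k. Suc k < N \<and> t k \<noteq> t (Suc k)}"

definition twist :: "(nat \<Rightarrow> bool) \<Rightarrow> nat \<Rightarrow> bool" where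
  "twist t k \<longleftrightarrow> t k \<noteq> odd k"

lemma twist_twist [simp]: "twist (twist t) = t"
  by (auto simp: twist_def)

text \<open>Neighbours have opposite parities, so each of the \<open>N - 1\<close> neighbouring
  pairs is a change in exactly one of \<open>t\<close> and \<open>twist t\<close>.\<close>

lemma changes_twist: "changes N (twist t) + changes N t = N - 1"
proof -
  have "{k. Suc k < N \<and> twist t k \<noteq> twist t (Suc k)} \<union> {k. Suc k < N \<and> t k \<noteq> t (Suc k)}
      = {..<N - 1}"
    by (auto simp: twist_def)
  moreover have "{k. Suc k < N \<and> twist t k \<noteq> twist t (Suc k)}
      \<inter> {k. Suc k < N \<and> t k \<noteq> t (Suc k)} = {}"
    by (auto simp: twist_def)
  moreover have "finite {k. Suc k < N \<and> P k}" for P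
    by (rule finite_subset[of _ "{..<N}"]) auto
  ultimately show ?thesis
    unfolding changes_def
    using card_Un_disjoint[of "{k. Suc k < N \<and> twist t k \<noteq> twist t (Suc k)}"
        "{k. Suc k < N \<and> t k \<noteq> t (Suc k)}"] by simp
qed

section \<open>Partial sign patterns of the beads\<close>

definition extends :: "(nat \<times> bool) set \<Rightarrow> (nat \<Rightarrow> bool) \<Rightarrow> bool" where
  "extends X y \<longleftrightarrow> (\<forall>(k, b)\<in>X. y k = b)"

text \<open>For a signed set this is the number of sign changes along its literals in order of
  position. Written as a minimum over extensions, it visibly grows with \<open>X\<close>.\<close>

definition min_changes :: "nat \<Rightarrow> (nat \<times> bool) set \<Rightarrow> nat" where
  "min_changes N X = (LEAST c. \<exists>y. extends X y \<and> changes N y = c)"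

definition first_sign :: "(nat \<times> bool) set \<Rightarrow> bool" where
  "first_sign X \<longleftrightarrow> ((LEAST k. k \<in> fst ` X), True) \<in> X"

lemma min_changes_le: "extends X y \<Longrightarrow> min_changes N X \<le> changes N y"
  unfolding min_changes_def by (rule Least_le) auto

lemma min_changes_attained:
  assumes "signed_set N X"
  obtains y where "extends X y" "changes N y = min_changes N X"
proof -
  have inj: "inj_on fst X" using assms by (simp add: signed_set_def)
  have "extends X (\<lambda>k. (k, True) \<in> X)"
    unfolding extends_def
  proof (clarify)
    fix k b assume "(k, b) \<in> X"
    then show "((k, True) \<in> X) = b"
      using inj_onD[OF inj, of "(k, True)" "(k, False)"] by (cases b) auto
  qed
  then have "\<exists>c. \<exists>y. extends X y \<and> changes N y = c" by blast
  from LeastI_ex[OF this] show thesis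
    unfolding min_changes_def[symmetric] using that by blast
qed

lemma first_literal:
  assumes "signed_set N X" "X \<noteq> {}"
  shows "((LEAST k. k \<in> fst ` X), first_sign X) \<in> X"
proof -
  have "\<exists>k. k \<in> fst ` X" using assms(2) by auto
  from LeastI_ex[OF this] obtain b where "((LEAST k. k \<in> fst ` X), b) \<in> X" by auto
  then show ?thesis
    by (cases b; cases "((LEAST k. k \<in> fst ` X), True) \<in> X") (simp_all add: first_sign_def)
qed

text \<open>Making a minimizer constant up to the first literal would save a change.\<close>

lemma first_sign_minimizer:
  assumes X: "signed_set N X" "X \<noteq> {}" and y: "extends X y" "changes N y = min_changes N X"
  shows "y 0 = first_sign X"
proof (rule ccontr)
  assume neq: "y 0 \<noteq> first_sign X"
  define k where "k = (LEAST k. k \<in> fst ` X)"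
  have kX: "(k, first_sign X) \<in> X" using first_literal[OF X] by (simp add: k_def)
  then have yk: "y k = first_sign X" and kN: "k < N"
    using y(1) X(1) by (auto simp: extends_def signed_set_def)
  have least: "k \<le> j" if "(j, b) \<in> X" for j b
    unfolding k_def using that by (intro Least_le) force
  define z where "z j = (if j < k then first_sign X else y j)" for j
  have "extends X z" using y(1) least unfolding extends_def z_def by fastforce
  then have "changes N y \<le> changes N z" using min_changes_le y(2) by metis
  moreover have "\<exists>j<k. y j \<noteq> y (Suc j)"
  proof (rule ccontr)
    assume "\<not> ?thesis"
    then have "y j = y 0" if "j \<le> k" for j using that by (induction j) auto
    from this[of k] yk neq show False by auto
  qed
  then obtain j where j: "j < k" "y j \<noteq> y (Suc j)" by blast
  have zSuc: "z (Suc i) = first_sign X" if "i < k" for i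
    using that yk by (cases "Suc i = k") (auto simp: z_def)
  have z0: "z i = first_sign X" if "i < k" for i using that by (simp add: z_def)
  have "{i. Suc i < N \<and> z i \<noteq> z (Suc i)} \<subset> {i. Suc i < N \<and> y i \<noteq> y (Suc i)}"
  proof (rule psubsetI)
    show "{i. Suc i < N \<and> z i \<noteq> z (Suc i)} \<subseteq> {i. Suc i < N \<and> y i \<noteq> y (Suc i)}"
    proof
      fix i assume i: "i \<in> {i. Suc i < N \<and> z i \<noteq> z (Suc i)}"
      then have "\<not> i < k" using zSuc[of i] z0[of i] by auto
      with i show "i \<in> {i. Suc i < N \<and> y i \<noteq> y (Suc i)}" by (auto simp: z_def)
    qed
    have "z j = z (Suc j)" using zSuc z0 j by simp
    moreover have "Suc j < N" using j kN by simp
    ultimately show "{i. Suc i < N \<and> z i \<noteq> z (Suc i)} \<noteq> {i. Suc i < N \<and> y i \<noteq> y (Suc i)}"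
      using j(2) by blast
  qed
  moreover have "finite {i. Suc i < N \<and> y i \<noteq> y (Suc i)}"
    by (rule finite_subset[of _ "{..<N}"]) auto
  ultimately have "changes N z < changes N y" unfolding changes_def by (intro psubset_card_mono)
  with \<open>changes N y \<le> changes N z\<close> show False by simp
qed

text \<open>A minimizer for \<open>Y\<close> extends \<open>X\<close> as well and, as the minima
  agree, is a minimizer for \<open>X\<close>. Its value at 0 is both first signs.\<close>

lemma first_sign_eq:
  assumes "signed_set N X" "signed_set N Y" "X \<noteq> {}" "X \<subseteq> Y"
    "min_changes N X = min_changes N Y"
  shows "first_sign X = first_sign Y"
proof -
  obtain y where y: "extends Y y" "changes N y = min_changes N Y"
    using min_changes_attained[OF assms(2)] .
  moreover have "extends X y" using assms(4) y by (auto simp: extends_def)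
  ultimately show ?thesis
    using first_sign_minimizer[of N X y] first_sign_minimizer[of N Y y] assms by auto
qed

lemma min_changes_neg: "min_changes N (neg_set X) = min_changes N X"
proof -
  have 1: "extends (neg_set X) y \<longleftrightarrow> extends X (\<lambda>k. \<not> y k)" for X y
    by (auto simp: extends_def)
  have 2: "changes N (\<lambda>k. \<not> y k) = changes N y" for y
    by (simp add: changes_def)
  have "(\<exists>y. extends (neg_set X) y \<and> changes N y = c) \<longleftrightarrow> (\<exists>y. extends X y \<and> changes N y = c)" for c
  proof
    assume "\<exists>y. extends X y \<and> changes N y = c"
    then obtain y where "extends X y" "changes N y = c" by blast
    then show "\<exists>y. extends (neg_set X) y \<and> changes N y = c"
      using 1[of X "\<lambda>k. \<not> y k"] 2[of y] by auto
  qed (use 1 2 in metis)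
  then show ?thesis by (simp add: min_changes_def)
qed

lemma signed_set_neg: "signed_set N X \<Longrightarrow> signed_set N (neg_set X)"
  by (auto simp: signed_set_def inj_on_def)

lemma first_sign_neg:
  assumes "signed_set N X" "X \<noteq> {}"
  shows "first_sign (neg_set X) \<longleftrightarrow> \<not> first_sign X"
proof -
  have "fst ` neg_set X = fst ` X" by (simp add: image_image)
  then have "((LEAST k. k \<in> fst ` X), first_sign (neg_set X)) \<in> neg_set X"
    using first_literal[of N "neg_set X"] signed_set_neg assms by auto
  then obtain b where b: "((LEAST k. k \<in> fst ` X), b) \<in> X" "first_sign (neg_set X) = (\<not> b)" by auto
  have "inj_on fst X" using assms(1) by (simp add: signed_set_def)
  from inj_onD[OF this _ b(1) first_literal[OF assms]] have "b = first_sign X" by simp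
  with b show ?thesis by simp
qed

text \<open>\<open>X\<close> prescribes the twisted pattern, so its literals are read through the
  parity of the position: \<open>s\<close> is the sign of the bead before twisting.\<close>

definition share :: "(nat \<Rightarrow> nat) \<Rightarrow> (nat \<times> bool) set \<Rightarrow> nat \<Rightarrow> bool \<Rightarrow> (nat \<times> bool) set" where
  "share col X i s = {p \<in> X. col (fst p) = i \<and> (snd p \<noteq> odd (fst p)) = s}"

lemma share_neg: "share col (neg_set X) i s = neg_set (share col X i (\<not> s))"
  by (auto simp: share_def)

lemma card_share_neg: "card (share col (neg_set X) i s) = card (share col X i (\<not> s))"
  unfolding share_neg by (rule card_image) (auto simp: inj_on_def)

lemma finite_signed_set: "signed_set N X \<Longrightarrow> finite X"
  unfolding signed_set_def by (auto intro: finite_subset[of X "{..<N} \<times> UNIV"])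

lemma card_share_le:
  assumes "signed_set N X"
  shows "card (share col X i s) + card (share col X i (\<not> s)) \<le> card {k. k < N \<and> col k = i}"
proof -
  have inj: "inj_on fst X" using assms by (simp add: signed_set_def)
  have "card (share col X i s) + card (share col X i (\<not> s))
      = card (share col X i s \<union> share col X i (\<not> s))"
    using finite_signed_set[OF assms]
    by (intro card_Un_disjoint[symmetric]) (auto simp: share_def)
  also have "\<dots> = card (fst ` (share col X i s \<union> share col X i (\<not> s)))"
    by (intro card_image[symmetric] inj_on_subset[OF inj]) (auto simp: share_def)
  also have "\<dots> \<le> card {k. k < N \<and> col k = i}"
    using assms by (intro card_mono) (auto simp: share_def signed_set_def)
  finally show ?thesis .
qed

text \<open>In each colour, the beads prescribed positive before twisting can be completed to
  exactly half of the beads without touching those prescribed negative, because neither group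
  exceeds \<open>h i\<close>.\<close>

lemma balanced_extension:
  assumes X: "signed_set N X" and col: "\<And>k. k < N \<Longrightarrow> col k < n"
    and card_col: "\<And>i. i < n \<Longrightarrow> card {k. k < N \<and> col k = i} = 2 * h i"
    and small: "\<And>i s. i < n \<Longrightarrow> card (share col X i s) \<le> h i"
  obtains y where "extends X (twist y)" "\<And>i. i < n \<Longrightarrow> card {k. k < N \<and> col k = i \<and> y k} = h i"
proof -
  have inj: "inj_on fst X" using X by (simp add: signed_set_def)
  have "\<exists>R. fst ` share col X i True \<subseteq> R
      \<and> R \<subseteq> {k. k < N \<and> col k = i} - fst ` share col X i False \<and> card R = h i"
    if i: "i < n" for i
  proof (rule exists_subset_between)
    have card_fst: "card (fst ` share col X i s) = card (share col X i s)" for s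
      by (intro card_image inj_on_subset[OF inj]) (auto simp: share_def)
    show "card (fst ` share col X i True) \<le> h i" using card_fst small[OF i] by simp
    have "fst ` share col X i False \<subseteq> {k. k < N \<and> col k = i}"
      using X by (auto simp: share_def signed_set_def)
    moreover from this have "finite (fst ` share col X i False)" by (rule finite_subset) simp
    ultimately show "h i \<le> card ({k. k < N \<and> col k = i} - fst ` share col X i False)"
      using card_col[OF i] card_fst[of False] small[OF i, of False]
      by (subst card_Diff_subset) auto
    show "fst ` share col X i True \<subseteq> {k. k < N \<and> col k = i} - fst ` share col X i False"
    proof (intro subsetI DiffI)
      fix k assume k: "k \<in> fst ` share col X i True"
      then show "k \<in> {k. k < N \<and> col k = i}" using X by (auto simp: share_def signed_set_def)
      from k obtain b where b: "(k, b) \<in> X" "b \<noteq> odd k" by (auto simp: share_def)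
      show "k \<notin> fst ` share col X i False"
      proof
        assume "k \<in> fst ` share col X i False"
        then obtain c where c: "(k, c) \<in> X" "c = odd k" by (auto simp: share_def)
        from inj_onD[OF inj _ b(1) c(1)] b c show False by simp
      qed
    qed
  qed auto
  then obtain R where R: "\<And>i. i < n \<Longrightarrow> fst ` share col X i True \<subseteq> R i"
    "\<And>i. i < n \<Longrightarrow> R i \<subseteq> {k. k < N \<and> col k = i} - fst ` share col X i False"
    "\<And>i. i < n \<Longrightarrow> card (R i) = h i"
    by metis
  show thesis
  proof (rule that)
    show "extends X (twist (\<lambda>k. k \<in> R (col k)))"
      unfolding extends_def
    proof clarify
      fix k b assume kb: "(k, b) \<in> X"
      then have "col k < n" using X col by (auto simp: signed_set_def)
      have "(k, b) \<in> share col X (col k) (b \<noteq> odd k)" using kb by (simp add: share_def)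
      then have "k \<in> fst ` share col X (col k) (b \<noteq> odd k)" by force
      then have "k \<in> R (col k) \<longleftrightarrow> (b \<noteq> odd k)"
        using R(1,2)[OF \<open>col k < n\<close>] by (cases "b \<noteq> odd k") auto
      then show "twist (\<lambda>k. k \<in> R (col k)) k = b" by (auto simp: twist_def)
    qed
    fix i assume i: "i < n"
    have "{k. k < N \<and> col k = i \<and> k \<in> R (col k)} = R i" using R(2)[OF i] by auto
    then show "card {k. k < N \<and> col k = i \<and> k \<in> R (col k)} = h i" using R(3)[OF i] by simp
  qed
qed

text \<open>If no balanced colouring had at most \<open>n\<close> changes, the following would be a Tucker labelling
  with labels below \<open>N\<close>. Twisting by the parity of the position turns few changes into many, so
  that the number of changes, minimized over all extensions, grows with the signed set.\<close>

definition necklace_label :: "nat \<Rightarrow> nat \<Rightarrow> (nat \<Rightarrow> nat) \<Rightarrow> (nat \<Rightarrow> nat) \<Rightarrow> (nat \<times> bool) set \<Rightarrow> int" where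
  "necklace_label N n col h X =
     (if \<exists>i<n. \<exists>s. card (share col X i s) > h i
      then let i = (LEAST i. i < n \<and> (\<exists>s. card (share col X i s) > h i))
        in (if card (share col X i True) > h i then 1 else - 1) * (int i + 1)
      else (if first_sign X then 1 else - 1) * (int n + 1 + int (min_changes N X)))"

text \<open>Labels of absolute value at most \<open>n\<close> name the least colour of which one
  sign holds more than half; the larger ones \<open>n + 1 + c\<close> record a number
  \<open>c\<close> of changes. Without a good pattern all of them stay below \<open>N\<close>,
  against \<open>large_label\<close>.\<close>

lemma discrete_necklace_splitting:
  assumes col: "\<And>k. k < N \<Longrightarrow> col k < n"
    and card_col: "\<And>i. i < n \<Longrightarrow> card {k. k < N \<and> col k = i} = 2 * h i"
  obtains t where "changes N t \<le> n" "\<And>i. i < n \<Longrightarrow> card {k. k < N \<and> col k = i \<and> t k} = h i"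
proof (rule ccontr)
  assume "\<not> thesis"
  then have many: "changes N t > n" if "\<And>i. i < n \<Longrightarrow> card {k. k < N \<and> col k = i \<and> t k} = h i" for t
    using that \<open>\<And>t. \<lbrakk>changes N t \<le> n; \<And>i. i < n \<Longrightarrow> card {k. k < N \<and> col k = i \<and> t k} = h i\<rbrakk>
      \<Longrightarrow> thesis\<close> not_le by blast
  define maj where "maj X i s \<longleftrightarrow> card (share col X i s) > h i" for X i s
  define lam where "lam = necklace_label N n col h"
  define idx where "idx X = (LEAST i. i < n \<and> (\<exists>s. maj X i s))" for X
  define has_maj where "has_maj X \<longleftrightarrow> (\<exists>i<n. \<exists>s. maj X i s)" for X
  have lam: "lam X = (if has_maj X then (if maj X (idx X) True then 1 else - 1) * (int (idx X) + 1)
      else (if first_sign X then 1 else - 1) * (int n + 1 + int (min_changes N X)))" for X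
    unfolding lam_def necklace_label_def maj_def idx_def has_maj_def Let_def by (rule refl)
  have not_both: "\<not> (maj X i s \<and> maj X i (\<not> s))" if "signed_set N X" "i < n" for X i s
    using card_share_le[OF that(1), of col i s] card_col[OF that(2)] by (auto simp: maj_def)
  have maj_neg: "maj (neg_set X) i s \<longleftrightarrow> maj X i (\<not> s)" for X i s
    by (simp add: maj_def card_share_neg)
  have ex_flip: "(\<exists>s. P (\<not> s)) \<longleftrightarrow> (\<exists>s. P s)" for P :: "bool \<Rightarrow> bool"
    by (auto simp: ex_bool_eq)
  have idx: "idx X < n \<and> (\<exists>s. maj X (idx X) s)" if "has_maj X" for X
    using LeastI_ex[of "\<lambda>i. i < n \<and> (\<exists>s. maj X i s)"] that by (auto simp: idx_def has_maj_def)
  have maj_mono: "maj Y i s" if "maj X i s" "X \<subseteq> Y" "signed_set N Y" for X Y i s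
  proof -
    have "card (share col X i s) \<le> card (share col Y i s)"
      using that finite_signed_set[of N Y] by (intro card_mono) (auto simp: share_def)
    with that(1) show ?thesis by (simp add: maj_def)
  qed
  \<comment> \<open>\<open>X\<close> extends to a twisted balanced pattern. Before twisting it has
    at least \<open>n + 1\<close> changes, so after twisting at most \<open>N - 2 - n\<close>; this
    leaves just enough room for the offset \<open>n + 1\<close>.\<close>
  have bound: "n + 1 + min_changes N X < N" if X: "signed_set N X" "\<not> has_maj X" for X
  proof -
    obtain y where y: "extends X (twist y)"
      "\<And>i. i < n \<Longrightarrow> card {k. k < N \<and> col k = i \<and> y k} = h i"
    proof (rule balanced_extension[OF X(1) col card_col])
      fix i s assume "i < n"
      then show "card (share col X i s) \<le> h i"
        using X(2) not_less unfolding has_maj_def maj_def by blast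
    qed auto
    have "min_changes N X \<le> changes N (twist y)" using min_changes_le[OF y(1)] .
    moreover have "changes N y > n" using many y(2) by blast
    ultimately show ?thesis using changes_twist[of N y] by linarith
  qed
  interpret tucker_labelling N lam
  proof
    fix X assume X: "signed_set N X" "X \<noteq> {}"
    show "lam (neg_set X) = - lam X"
    proof (cases "has_maj X")
      case True
      have idx_neg: "idx (neg_set X) = idx X"
        unfolding idx_def maj_neg ex_flip ..
      have "maj X (idx X) False \<longleftrightarrow> \<not> maj X (idx X) True"
        using idx[OF True] not_both[OF X(1), of "idx X" True] by (auto simp: ex_bool_eq)
      moreover have "has_maj (neg_set X)"
        using True unfolding has_maj_def maj_neg ex_flip .
      ultimately show ?thesis using True idx_neg by (simp add: lam maj_neg)
    next
      case False
      have "\<not> has_maj (neg_set X)" using False unfolding has_maj_def maj_neg ex_flip .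
      with False show ?thesis using first_sign_neg[OF X] by (simp add: lam min_changes_neg)
    qed
    show "lam X \<noteq> 0" unfolding lam by auto
  next
    fix X Y assume XY: "signed_set N X" "signed_set N Y" "X \<noteq> {}" "X \<subseteq> Y"
    show "lam Y \<noteq> - lam X"
    proof
      assume eq: "lam Y = - lam X"
      have abs_lam: "\<bar>lam Z\<bar> = (if has_maj Z then int (idx Z) + 1
          else int n + 1 + int (min_changes N Z))" for Z
        unfolding lam by (simp add: abs_mult)
      have abs_eq: "\<bar>lam X\<bar> = \<bar>lam Y\<bar>" using eq by simp
      \<comment> \<open>The ranges up to \<open>n\<close> and from \<open>n + 1\<close> on are
        disjoint, so equal absolute values come from the same branch.\<close>
      have same: "has_maj X = has_maj Y"
        using abs_eq idx[of X] idx[of Y] unfolding abs_lam by (auto split: if_splits)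
      show False
      proof (cases "has_maj X")
        case True
        with same abs_eq have i: "idx Y = idx X" unfolding abs_lam by simp
        \<comment> \<open>A majority of sign \<open>s\<close> in \<open>X\<close> persists in
          \<open>Y\<close>, and a colour cannot have majorities of both signs, so the two labels
          cannot differ in sign.\<close>
        from True same i eq have "maj X (idx X) True \<noteq> maj Y (idx X) True"
          unfolding lam by (auto split: if_splits)
        moreover obtain s where "maj X (idx X) s" using idx[OF True] by blast
        moreover have "maj Y (idx X) s" using \<open>maj X (idx X) s\<close> XY maj_mono by blast
        ultimately show False
          using not_both[OF XY(1), of "idx X" s] not_both[OF XY(2), of "idx X" s] idx[OF True]
          by (cases s) auto
      next
        case False
        with same abs_eq have "min_changes N X = min_changes N Y" unfolding abs_lam by simp
        then have "first_sign X = first_sign Y" using first_sign_eq XY by blast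
        with False same eq show False unfolding lam by (auto split: if_splits)
      qed
    qed
  qed
  have "n < N" using bound[of "{}"]
    by (auto simp: has_maj_def maj_def share_def signed_set_def)
  then obtain X where X: "signed_set N X" "X \<noteq> {}" "\<bar>lam X\<bar> \<ge> int N" using large_label by auto
  show False
  proof (cases "has_maj X")
    case True
    then have "\<bar>lam X\<bar> \<le> int n" using idx[OF True] unfolding lam by (auto simp: abs_mult)
    with X(3) \<open>n < N\<close> show False by linarith
  next
    case False
    then have "\<bar>lam X\<bar> = int n + 1 + int (min_changes N X)" unfolding lam by (auto simp: abs_mult)
    with bound[OF X(1) False] X(3) show False by linarith
  qed
qed

section \<open>The Hobby--Rice theorem\<close>

definition cuts :: "nat \<Rightarrow> (nat \<Rightarrow> real) \<Rightarrow> bool" where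
  "cuts n z \<longleftrightarrow> z 0 = 0 \<and> z (Suc n) = 1 \<and> (\<forall>j\<le>n. z j \<le> z (Suc j))"

text \<open>For a distribution function \<open>F\<close> this is the mass of the pieces of even
  index minus that of the pieces of odd index, so its vanishing means bisection.\<close>

definition alternating_sum :: "nat \<Rightarrow> (nat \<Rightarrow> real) \<Rightarrow> (real \<Rightarrow> real) \<Rightarrow> real" where
  "alternating_sum n z F = (\<Sum>j\<le>n. (- 1) ^ j * (F (z (Suc j)) - F (z j)))"

abbreviation sign_of :: "bool \<Rightarrow> real" where
  "sign_of b \<equiv> (if b then 1 else - 1)"

lemma changes_Suc:
  assumes "N > 0"
  shows "changes (Suc N) e = changes N e + of_bool (e (N - 1) \<noteq> e N)"
proof -
  have fin: "finite {k. Suc k < N \<and> e k \<noteq> e (Suc k)}"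
    by (rule finite_subset[of _ "{..<N}"]) auto
  have "{k. Suc k < Suc N \<and> e k \<noteq> e (Suc k)}
      = {k. Suc k < N \<and> e k \<noteq> e (Suc k)} \<union> (if e (N - 1) \<noteq> e N then {N - 1} else {})"
    using assms by (auto simp: less_Suc_eq)
  with fin assms show ?thesis by (auto simp: changes_def)
qed

text \<open>Consecutive intervals of equal sign are fused, so a cut remains only where the sign
  changes. \<open>alternating_sum\<close> always begins with a plus sign, whence the factor
  \<open>sign_of (e 0)\<close>. The equation for the last sign is carried through the induction to
  know with which sign the next interval enters.\<close>

lemma merge_blocks:
  assumes "N > 0" "\<forall>k<N. P k \<le> P (Suc k)"
  shows "\<exists>z. z 0 = P 0 \<and> z (Suc (changes N e)) = P N \<and> (\<forall>j\<le>changes N e. z j \<le> z (Suc j))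
    \<and> sign_of (e (N - 1)) = sign_of (e 0) * (- 1) ^ changes N e
    \<and> (\<forall>F. alternating_sum (changes N e) z F
        = sign_of (e 0) * (\<Sum>k<N. sign_of (e k) * (F (P (Suc k)) - F (P k))))"
  using assms
proof (induction N rule: nat_induct_non_zero)
  case 1
  have "changes 1 e = 0" by (simp add: changes_def)
  with 1 show ?case by (intro exI[of _ P]) (auto simp: alternating_sum_def)
next
  case (Suc N)
  let ?m = "changes N e"
  have "\<forall>k<N. P k \<le> P (Suc k)" using Suc.prems by simp
  from Suc.IH[OF this] obtain z where z: "z 0 = P 0" "z (Suc ?m) = P N"
    "\<And>j. j \<le> ?m \<Longrightarrow> z j \<le> z (Suc j)"
    "sign_of (e (N - 1)) = sign_of (e 0) * (- 1) ^ ?m"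
    "\<And>F. alternating_sum ?m z F
        = sign_of (e 0) * (\<Sum>k<N. sign_of (e k) * (F (P (Suc k)) - F (P k)))"
    by blast
  have PN: "P N \<le> P (Suc N)" using Suc.prems by simp
  have sq: "sign_of (e 0) * sign_of (e 0) = 1" by simp
  show ?case
  proof (cases "e (N - 1) = e N")
    case True
    define z' where "z' = z(Suc ?m := P (Suc N))"
    have m': "changes (Suc N) e = ?m" using changes_Suc[OF \<open>N > 0\<close>, of e] True by simp
    have sgn: "sign_of (e N) = sign_of (e 0) * (- 1) ^ ?m" using z(4) True by simp
    have sgn': "(- 1) ^ ?m = sign_of (e 0) * sign_of (e N)" using sgn sq by (simp split: if_splits)
    have ord: "z' j \<le> z' (Suc j)" if "j \<le> ?m" for j
      using z(3)[OF that] z(2) PN that by (auto simp: z'_def le_Suc_eq)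
    have "alternating_sum ?m z' F
        = sign_of (e 0) * (\<Sum>k<Suc N. sign_of (e k) * (F (P (Suc k)) - F (P k)))" for F
    proof -
      have "alternating_sum ?m z' F = alternating_sum ?m z F + (- 1) ^ ?m * (F (P (Suc N)) - F (P N))"
        using z(2)
        by (cases ?m) (auto simp: alternating_sum_def z'_def algebra_simps intro!: sum.cong)
      then show ?thesis unfolding z(5) sgn' by (simp add: algebra_simps)
    qed
    note alt = this
    have "sign_of (e (Suc N - 1)) = sign_of (e 0) * (- 1) ^ ?m" using sgn by simp
    moreover have "z' 0 = P 0" "z' (Suc ?m) = P (Suc N)" using z(1) by (simp_all add: z'_def)
    ultimately show ?thesis unfolding m' using ord alt by (intro exI[of _ z'] conjI allI impI)
  next
    case False
    define z' where "z' = z(Suc (Suc ?m) := P (Suc N))"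
    have m': "changes (Suc N) e = Suc ?m" using changes_Suc[OF \<open>N > 0\<close>, of e] False by simp
    have "sign_of (e N) = - sign_of (e (N - 1))" using False by auto
    then have sgn: "sign_of (e N) = sign_of (e 0) * (- 1) ^ Suc ?m" using z(4) by simp
    have sgn': "(- 1) ^ Suc ?m = sign_of (e 0) * sign_of (e N)"
      using sgn sq by (simp split: if_splits)
    have ord: "z' j \<le> z' (Suc j)" if "j \<le> Suc ?m" for j
      using z(3)[of j] z(2) PN that by (auto simp: z'_def le_Suc_eq)
    have "alternating_sum (Suc ?m) z' F
        = sign_of (e 0) * (\<Sum>k<Suc N. sign_of (e k) * (F (P (Suc k)) - F (P k)))" for F
    proof -
      have "alternating_sum (Suc ?m) z' F
          = alternating_sum ?m z F + (- 1) ^ Suc ?m * (F (P (Suc N)) - F (P N))"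
        using z(2) by (auto simp: alternating_sum_def z'_def intro!: sum.cong)
      then show ?thesis unfolding z(5) sgn' by (simp add: algebra_simps)
    qed
    note alt = this
    have "sign_of (e (Suc N - 1)) = sign_of (e 0) * (- 1) ^ Suc ?m" using sgn by simp
    moreover have "z' 0 = P 0" "z' (Suc (Suc ?m)) = P (Suc N)" using z(1) by (simp_all add: z'_def)
    ultimately show ?thesis unfolding m' using ord alt by (intro exI[of _ z'] conjI allI impI)
  qed
qed

text \<open>The missing cuts are put at 1, where they bound degenerate pieces that contribute
  nothing.\<close>

lemma pad_cuts:
  assumes "cuts m z" "m \<le> n"
  obtains z' where "cuts n z'" "\<And>F. alternating_sum n z' F = alternating_sum m z F"
proof
  define z' where "z' j = (if j \<le> m then z j else 1)" for j
  have z: "z 0 = 0" "z (Suc m) = 1" "\<And>j. j \<le> m \<Longrightarrow> z j \<le> z (Suc j)"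
    using assms(1) by (auto simp: cuts_def)
  have "z' j \<le> z' (Suc j)" for j
    using z(2) z(3)[of j] by (cases "j < m"; cases "j = m") (auto simp: z'_def)
  then show "cuts n z'" using z assms(2) by (auto simp: cuts_def z'_def)
  fix F
  have eq: "z' j = z j" if "j \<le> Suc m" for j using that z(2) by (auto simp: z'_def le_Suc_eq)
  have "alternating_sum n z' F = (\<Sum>j\<le>m. (- 1) ^ j * (F (z' (Suc j)) - F (z' j)))"
    unfolding alternating_sum_def using assms(2)
    by (intro sum.mono_neutral_right) (auto simp: z'_def)
  also have "\<dots> = alternating_sum m z F" unfolding alternating_sum_def by (intro sum.cong) (auto simp: eq)
  finally show "alternating_sum n z' F = alternating_sum m z F" .
qed

section \<open>Beads at quantiles\<close>

lemma summation_by_parts: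
  fixes a E :: "nat \<Rightarrow> real"
  shows "(\<Sum>k<Suc N. a k * (E (Suc k) - E k))
    = a N * E (Suc N) - a 0 * E 0 - (\<Sum>k<N. (a (Suc k) - a k) * E (Suc k))"
  by (induction N) (auto simp: algebra_simps)

lemma quantile_exists:
  fixes F :: "real \<Rightarrow> real"
  assumes "continuous_on {0..1} F" "mono_on {0..1} F" "F 0 = 0" "0 \<le> s" "s \<le> 1"
  shows "\<exists>q\<in>{0..1}. F q = F 1 * s"
proof -
  have "F 0 \<le> F 1" using assms(2) by (auto intro: mono_onD)
  then have "F 0 \<le> F 1 * s" "F 1 * s \<le> F 1"
    using assms(3-5) by (auto simp: mult_left_le)
  from IVT'[OF this _ assms(1)] show ?thesis by auto
qed

text \<open>Measured in bead weights, \<open>p\<close> lies at \<open>u = F p / c\<close>; by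
  monotonicity \<open>A\<close> contains all indices below \<open>u\<close> and none above it, so
  its size differs from \<open>u\<close> by at most 1. \<open>A\<close> is only sandwiched because
  sorting may order beads at equal positions in any way.\<close>

lemma count_quantiles:
  fixes F :: "real \<Rightarrow> real"
  assumes "mono_on {0..1} F" "c \<ge> 0" "0 \<le> F p" "F p \<le> c * real L" "p \<in> {0..1}"
    and q: "\<And>a. a < L \<Longrightarrow> q a \<in> {0..1} \<and> F (q a) = c * real a"
    and A: "{a. a < L \<and> q a < p} \<subseteq> A" "A \<subseteq> {a. a < L \<and> q a \<le> p}"
  shows "\<bar>F p - c * real (card A)\<bar> \<le> c"
proof (cases "c = 0")
  case True
  then show ?thesis using assms(3,4) by simp
next
  case False
  then have c: "c > 0" using assms(2) by simp
  define u where "u = F p / c"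
  have Fp: "F p = c * u" using c by (simp add: u_def)
  have u: "0 \<le> u" "u \<le> real L" using assms(3,4) c unfolding Fp by (auto simp: zero_le_mult_iff)
  have finA: "finite A" using A(2) by (rule finite_subset) auto
  have "{..<nat \<lceil>u\<rceil>} \<subseteq> A"
  proof
    fix a assume "a \<in> {..<nat \<lceil>u\<rceil>}"
    then have a: "real a < u" by (simp add: zless_nat_eq_int_zless less_ceiling_iff)
    then have "a < L" using u by linarith
    have "F (q a) < F p" using a c q[OF \<open>a < L\<close>] by (simp add: Fp)
    then have "q a < p"
      using mono_onD[OF assms(1) assms(5), of "q a"] q[OF \<open>a < L\<close>] by (meson linorder_not_less)
    then show "a \<in> A" using A(1) \<open>a < L\<close> by auto
  qed
  from card_mono[OF finA this] have "u \<le> real (card A)" by simp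
  moreover have "A \<subseteq> {..nat \<lfloor>u\<rfloor>}"
  proof
    fix a assume "a \<in> A"
    then have a: "a < L" "q a \<le> p" using A(2) by auto
    have "F (q a) \<le> F p"
      using mono_onD[OF assms(1) _ assms(5) a(2)] q[OF a(1)] by simp
    then have "real a \<le> u" using c q[OF a(1)] by (simp add: Fp)
    then show "a \<in> {..nat \<lfloor>u\<rfloor>}" by (simp add: le_nat_floor)
  qed
  then have "card A \<le> card {..nat \<lfloor>u\<rfloor>}" by (intro card_mono) auto
  then have "real (card A) \<le> u + 1" using u by simp linarith
  ultimately have "\<bar>u - real (card A)\<bar> \<le> 1" by linarith
  then have "c * \<bar>u - real (card A)\<bar> \<le> c" using c by (simp add: mult_left_le)
  moreover have "\<bar>F p - c * real (card A)\<bar> = c * \<bar>u - real (card A)\<bar>"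
    using c by (simp add: Fp right_diff_distrib[symmetric] abs_mult)
  ultimately show ?thesis by simp
qed

text \<open>Each function gets \<open>2 * M\<close> beads of weight \<open>c\<close>, its total mass
  divided by \<open>2 * M\<close>, and half of them get each sign. The discrepancy \<open>E\<close>
  between mass and weighted bead count is at most \<open>c\<close> and enters with factor 2 at each
  of at most \<open>n\<close> sign changes.\<close>

lemma approximate_bisection:
  fixes F :: "nat \<Rightarrow> real \<Rightarrow> real"
  assumes cont: "\<And>i. i < n \<Longrightarrow> continuous_on {0..1} (F i)"
    and mono: "\<And>i. i < n \<Longrightarrow> mono_on {0..1} (F i)"
    and F0: "\<And>i. i < n \<Longrightarrow> F i 0 = 0" and M: "M > 0"
  shows "\<exists>z. cuts n z \<and> (\<forall>i<n. \<bar>alternating_sum n z (F i)\<bar> \<le> real n * F i 1 / real M)"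
proof (cases "n = 0")
  case True
  then show ?thesis by (intro exI[of _ "\<lambda>j. if j = 0 then 0 else 1"]) (auto simp: cuts_def)
next
  case n: False
  define L where "L = 2 * M"
  have L: "L > 0" using M by (simp add: L_def)
  define q where "q i a = (SOME x. x \<in> {0..1} \<and> F i x = F i 1 / real L * real a)" for i a
  have q: "q i a \<in> {0..1} \<and> F i (q i a) = F i 1 / real L * real a" if "i < n" "a < L" for i a
  proof -
    have "\<exists>x. x \<in> {0..1} \<and> F i x = F i 1 / real L * real a"
      using quantile_exists[OF cont[OF that(1)] mono[OF that(1)] F0[OF that(1)], of "real a / real L"]
        that(2) by auto
    then show ?thesis unfolding q_def by (rule someI_ex)
  qed
  define bs where "bs = sort_key (\<lambda>(i, a). q i a) (List.product [0..<n] [0..<L])"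
  define N where "N = length bs"
  have set_bs: "set bs = {..<n} \<times> {..<L}" by (auto simp: bs_def)
  have dist: "distinct bs" by (simp add: bs_def distinct_product)
  have "(0, 0) \<in> set bs" using n L by (simp add: set_bs)
  then have N: "N > 0" unfolding N_def by (rule length_pos_if_in_set)
  define col where "col k = fst (bs ! k)" for k
  define p where "p k = q (fst (bs ! k)) (snd (bs ! k))" for k
  have bs_nth: "fst (bs ! k) < n" "snd (bs ! k) < L" if "k < N" for k
    using nth_mem[of k bs] that unfolding N_def set_bs by (simp_all add: mem_Times_iff)
  have p_mono: "p j \<le> p k" if "j \<le> k" "k < N" for j k
  proof -
    have "sorted (map (\<lambda>(i, a). q i a) bs)" by (simp add: bs_def)
    from sorted_nth_mono[OF this that(1)] that show ?thesis
      by (simp add: N_def p_def case_prod_unfold)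
  qed
  have p01: "p k \<in> {0..1}" if "k < N" for k using q bs_nth[OF that] by (simp add: p_def)
  have inj: "inj_on (\<lambda>k. snd (bs ! k)) {k. k < N \<and> col k = i}" for i
  proof (rule inj_onI)
    fix j k assume *: "j \<in> {k. k < N \<and> col k = i}" "k \<in> {k. k < N \<and> col k = i}"
      "snd (bs ! j) = snd (bs ! k)"
    then have "bs ! j = bs ! k" by (auto simp: col_def prod_eq_iff)
    then show "j = k" using * dist by (simp add: N_def nth_eq_iff_index_eq)
  qed
  have card_col: "card {k. k < N \<and> col k = i} = 2 * M" if i: "i < n" for i
  proof -
    have "(\<lambda>k. snd (bs ! k)) ` {k. k < N \<and> col k = i} = {..<L}"
    proof (intro equalityI subsetI)
      fix a assume "a \<in> {..<L}"
      then have "(i, a) \<in> set bs" using i set_bs by auto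
      then obtain k where "k < N" "bs ! k = (i, a)" by (auto simp: in_set_conv_nth N_def)
      then show "a \<in> (\<lambda>k. snd (bs ! k)) ` {k. k < N \<and> col k = i}"
        by (auto simp: col_def intro!: image_eqI[of _ _ k])
    qed (use bs_nth in auto)
    from arg_cong[OF this, of card] show ?thesis using card_image[OF inj] by (simp add: L_def)
  qed
  obtain t where t: "changes N t \<le> n" "\<And>i. i < n \<Longrightarrow> card {k. k < N \<and> col k = i \<and> t k} = M"
    by (rule discrete_necklace_splitting[of N col n "\<lambda>_. M"])
      (use bs_nth card_col in \<open>auto simp: col_def\<close>)
  \<comment> \<open>\<open>N\<close> beads leave \<open>N + 1\<close> intervals. Bead
    \<open>k\<close> is the right end of interval \<open>k\<close> and gives it its sign; the
    interval after the last bead repeats the last sign and so adds no change.\<close>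
  define e where "e k = t (min k (N - 1))" for k
  define P where "P k = (if k = 0 then 0 else if k \<le> N then p (k - 1) else 1)" for k
  have P01: "P k \<in> {0..1}" for k using p01[of "k - 1"] by (auto simp: P_def)
  have P_mono: "\<forall>k<Suc N. P k \<le> P (Suc k)"
  proof (intro allI impI)
    fix k assume "k < Suc N"
    then show "P k \<le> P (Suc k)"
      using P01[of k] P01[of "Suc k"] p_mono[of "k - 1" k] by (auto simp: P_def)
  qed
  have e_change: "e k \<noteq> e (Suc k) \<longleftrightarrow> Suc k < N \<and> t k \<noteq> t (Suc k)" for k
  proof (cases "Suc k < N")
    case False
    then have "min k (N - 1) = N - 1" "min (Suc k) (N - 1) = N - 1" by auto
    with False show ?thesis by (simp add: e_def)
  qed (simp add: e_def)
  have e_changes: "changes (Suc N) e \<le> n"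
  proof -
    have "{k. Suc k < Suc N \<and> e k \<noteq> e (Suc k)} = {k. Suc k < N \<and> t k \<noteq> t (Suc k)}"
      unfolding e_change by auto
    then show ?thesis using t(1) by (simp add: changes_def)
  qed
  from merge_blocks[where N = "Suc N" and P = P and e = e, OF zero_less_Suc P_mono]
  obtain z where z: "z 0 = P 0" "z (Suc (changes (Suc N) e)) = P (Suc N)"
    "\<forall>j\<le>changes (Suc N) e. z j \<le> z (Suc j)"
    "\<forall>F. alternating_sum (changes (Suc N) e) z F
        = sign_of (e 0) * (\<Sum>k<Suc N. sign_of (e k) * (F (P (Suc k)) - F (P k)))"
    by (elim exE conjE) (rule that)
  have "cuts (changes (Suc N) e) z" using z(1-3) by (simp add: cuts_def P_def)
  from pad_cuts[OF this e_changes] obtain z' where z': "cuts n z'"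
    "\<And>F. alternating_sum n z' F = alternating_sum (changes (Suc N) e) z F" by blast
  have "\<bar>alternating_sum n z' (F i)\<bar> \<le> real n * F i 1 / real M" if i: "i < n" for i
  proof -
    define c where "c = F i 1 / real L"
    have c: "c \<ge> 0" "F i 1 = c * real L"
      using mono_onD[OF mono[OF i], of 0 1] F0[OF i] L by (auto simp: c_def)
    define B where "B k = {j. j < N \<and> j < k \<and> col j = i}" for k
    define D where "D k = real (card (B k))" for k
    \<comment> \<open>\<open>E\<close> vanishes at both ends, since all beads of colour
      \<open>i\<close> together weigh \<open>F i 1\<close>. No boundary term remains in the
      summation by parts.\<close>
    define E where "E k = F i (P k) - c * D k" for k
    have D_diff: "D (Suc k) - D k = of_bool (col k = i)" if "k < N" for k
    proof -
      have "B (Suc k) = B k \<union> (if col k = i then {k} else {})"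
        using that by (auto simp: B_def less_Suc_eq)
      then show ?thesis by (auto simp: D_def B_def)
    qed
    have D_last: "D (Suc N) = D N"
    proof -
      have "B (Suc N) = B N" by (auto simp: B_def)
      then show ?thesis by (simp add: D_def)
    qed
    have D_N: "D N = real L" using card_col[OF i] by (simp add: D_def B_def L_def)
    have E0: "E 0 = 0" using F0[OF i] by (simp add: E_def P_def D_def B_def)
    have EN: "E (Suc N) = 0" using D_last D_N c by (simp add: E_def P_def)
    have E_bound: "\<bar>E (Suc k)\<bar> \<le> c" if k: "k < N" for k
    proof -
      have inj': "inj_on (\<lambda>k. snd (bs ! k)) (B (Suc k))"
        by (rule inj_on_subset[OF inj[of i]]) (auto simp: B_def)
      have "\<bar>F i (p k) - c * real (card ((\<lambda>k. snd (bs ! k)) ` B (Suc k)))\<bar> \<le> c"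
      proof (rule count_quantiles[where F = "F i" and p = "p k" and c = c and L = L and q = "q i"])
        show "mono_on {0..1} (F i)" using mono[OF i] .
        show "0 \<le> F i (p k)"
          using mono_onD[OF mono[OF i], of 0 "p k"] p01[OF k] F0[OF i] by simp
        show "F i (p k) \<le> c * real L"
          using mono_onD[OF mono[OF i], of "p k" 1] p01[OF k] c(2) by simp
        show "p k \<in> {0..1}" "c \<ge> 0" using p01[OF k] c by auto
        show "q i a \<in> {0..1} \<and> F i (q i a) = c * real a" if "a < L" for a
          using q[OF i that] by (simp add: c_def)
        show "{a. a < L \<and> q i a < p k} \<subseteq> (\<lambda>k. snd (bs ! k)) ` B (Suc k)"
        proof
          fix a assume a: "a \<in> {a. a < L \<and> q i a < p k}"
          then have "(i, a) \<in> set bs" using i set_bs by auto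
          then obtain j where j: "j < N" "bs ! j = (i, a)" by (auto simp: in_set_conv_nth N_def)
          then have "p j < p k" using a by (simp add: p_def)
          then have "j < k" using p_mono[of k j] j by (meson not_le)
          then show "a \<in> (\<lambda>k. snd (bs ! k)) ` B (Suc k)"
            using j by (auto simp: B_def col_def intro!: image_eqI[of _ _ j])
        qed
        show "(\<lambda>k. snd (bs ! k)) ` B (Suc k) \<subseteq> {a. a < L \<and> q i a \<le> p k}"
          using bs_nth p_mono[OF _ k] by (auto simp: B_def col_def p_def less_Suc_eq_le)
      qed
      then show ?thesis
        using k card_image[OF inj'] by (simp add: E_def P_def D_def)
    qed
    \<comment> \<open>Half of the beads of colour \<open>i\<close> have sign 1, so the bead counts
      cancel and only \<open>E\<close> remains.\<close>
    have bal: "(\<Sum>k<N. sign_of (e k) * of_bool (col k = i)) = 0"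
    proof -
      have "(\<Sum>k<N. sign_of (e k) * of_bool (col k = i))
          = (\<Sum>k<N. 2 * of_bool (col k = i \<and> t k) - of_bool (col k = i) :: real)"
        by (intro sum.cong refl) (auto simp: e_def min_def)
      also have "\<dots> = 2 * real (card {k. k < N \<and> col k = i \<and> t k}) - real (card {k. k < N \<and> col k = i})"
        by (simp add: sum_subtractf sum_distrib_left[symmetric] Int_def)
      finally show ?thesis using t(2)[OF i] card_col[OF i] by simp
    qed
    have "(\<Sum>k<Suc N. sign_of (e k) * (F i (P (Suc k)) - F i (P k)))
        = (\<Sum>k<Suc N. sign_of (e k) * (E (Suc k) - E k))
          + c * (\<Sum>k<Suc N. sign_of (e k) * (D (Suc k) - D k))"
      unfolding sum_distrib_left sum.distrib[symmetric]
      by (intro sum.cong refl) (simp add: E_def algebra_simps)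
    also have "(\<Sum>k<Suc N. sign_of (e k) * (D (Suc k) - D k)) = 0"
      using bal D_last D_diff by simp
    also have "(\<Sum>k<Suc N. sign_of (e k) * (E (Suc k) - E k))
        = - (\<Sum>k<N. (sign_of (e (Suc k)) - sign_of (e k)) * E (Suc k))"
      unfolding summation_by_parts[of "\<lambda>k. sign_of (e k)"] E0 EN by simp
    finally have sum_eq: "(\<Sum>k<Suc N. sign_of (e k) * (F i (P (Suc k)) - F i (P k)))
        = - (\<Sum>k<N. (sign_of (e (Suc k)) - sign_of (e k)) * E (Suc k))" by simp
    have "\<bar>alternating_sum n z' (F i)\<bar>
        = \<bar>\<Sum>k<N. (sign_of (e (Suc k)) - sign_of (e k)) * E (Suc k)\<bar>"
      unfolding z'(2) z(4)[rule_format] sum_eq by (simp add: abs_mult)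
    also have "\<dots> \<le> (\<Sum>k<N. \<bar>(sign_of (e (Suc k)) - sign_of (e k)) * E (Suc k)\<bar>)"
      by (rule sum_abs)
    also have "\<dots> \<le> (\<Sum>k<N. of_bool (e k \<noteq> e (Suc k)) * (2 * c))"
      by (intro sum_mono) (use E_bound in \<open>auto simp: abs_mult\<close>)
    also have "\<dots> = real (changes (Suc N) e) * (2 * c)"
      by (simp add: changes_def sum_distrib_right[symmetric] Int_def)
    also have "\<dots> \<le> real n * (2 * c)" using e_changes c by (intro mult_right_mono) auto
    also have "\<dots> = real n * F i 1 / real M" using M by (simp add: c_def L_def)
    finally show ?thesis .
  qed
  with z'(1) show ?thesis by blast
qed

section \<open>Compactness and passage to the limit\<close>

lemma bounded_subsequence:
  fixes X :: "nat \<Rightarrow> nat \<Rightarrow> real"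
  assumes "\<And>m j. X m j \<in> {0..1}"
  shows "\<exists>r x. strict_mono (r :: nat \<Rightarrow> nat) \<and> (\<forall>j<n. x j \<in> {0..1} \<and> (\<lambda>m. X (r m) j) \<longlonglongrightarrow> x j)"
proof (induction n)
  case 0
  show ?case by (intro exI[of _ id]) (auto simp: strict_mono_id)
next
  case (Suc n)
  then obtain r x where rx: "strict_mono (r :: nat \<Rightarrow> nat)"
    "\<And>j. j < n \<Longrightarrow> x j \<in> {0..1} \<and> (\<lambda>m. X (r m) j) \<longlonglongrightarrow> x j" by blast
  have "seq_compact {0..1 :: real}" by (simp add: compact_imp_seq_compact)
  then obtain y s where ys: "y \<in> {0..1}" "strict_mono (s :: nat \<Rightarrow> nat)"
    "((\<lambda>m. X (r m) n) \<circ> s) \<longlonglongrightarrow> y"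
    using assms by (meson seq_compactE)
  have "strict_mono (r \<circ> s)" using rx ys by (simp add: strict_mono_o)
  moreover have "(x(n := y)) j \<in> {0..1} \<and> (\<lambda>m. X ((r \<circ> s) m) j) \<longlonglongrightarrow> (x(n := y)) j"
    if "j < Suc n" for j
  proof (cases "j = n")
    case True
    then show ?thesis using ys by (simp add: o_def)
  next
    case False
    then have j: "j < n" using that by simp
    have "((\<lambda>m. X (r m) j) \<circ> s) \<longlonglongrightarrow> x j" using rx(2)[OF j] ys(2) LIMSEQ_subseq_LIMSEQ by blast
    then show ?thesis using False rx(2)[OF j] by (simp add: o_def)
  qed
  ultimately show ?case by blast
qed

lemma cuts_mono:
  assumes "cuts n z" "i \<le> j" "j \<le> Suc n" shows "z i \<le> z j"
  using assms(2,3)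
proof (induction j rule: dec_induct)
  case (step j)
  then have "z i \<le> z j" "z j \<le> z (Suc j)" using assms(1) by (simp_all add: cuts_def)
  then show ?case by (rule order_trans)
qed auto

lemma cuts_in_unit_interval:
  assumes "cuts n z" "j \<le> Suc n" shows "z j \<in> {0..1}"
proof -
  have "z 0 \<le> z j" "z j \<le> z (Suc n)" using cuts_mono[OF assms(1)] assms(2) by auto
  then show ?thesis using assms(1) by (simp add: cuts_def)
qed

text \<open>The number of cuts stays \<open>n\<close> while the number of beads grows, so the
  approximate cuts live in a fixed compact cube. Continuity of \<open>F i\<close> carries the
  vanishing error to the limit; cuts may merge there, which \<open>cuts\<close> permits.\<close>

theorem Hobby_Rice:
  fixes F :: "nat \<Rightarrow> real \<Rightarrow> real"
  assumes cont: "\<And>i. i < n \<Longrightarrow> continuous_on {0..1} (F i)"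
    and mono: "\<And>i. i < n \<Longrightarrow> mono_on {0..1} (F i)"
    and F0: "\<And>i. i < n \<Longrightarrow> F i 0 = 0"
  obtains z where "cuts n z" "\<And>i. i < n \<Longrightarrow> alternating_sum n z (F i) = 0"
proof -
  have "\<forall>m. \<exists>z. cuts n z
      \<and> (\<forall>i<n. \<bar>alternating_sum n z (F i)\<bar> \<le> real n * F i 1 / real (Suc m))"
    by (intro allI approximate_bisection[OF assms] zero_less_Suc)
  then obtain X where X: "\<And>m. cuts n (X m)"
    "\<And>m i. i < n \<Longrightarrow> \<bar>alternating_sum n (X m) (F i)\<bar> \<le> real n * F i 1 / real (Suc m)"
    by metis
  \<comment> \<open>\<open>cuts\<close> says nothing about indices beyond \<open>Suc n\<close>; the
    default 0 puts them into the unit interval.\<close>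
  define Y where "Y m j = (if j \<le> Suc n then X m j else 0)" for m j
  have Y01: "Y m j \<in> {0..1}" for m j
    using cuts_in_unit_interval[OF X(1)] by (auto simp: Y_def)
  obtain r z where r: "strict_mono (r :: nat \<Rightarrow> nat)"
    and z: "\<And>j. j < n + 2 \<Longrightarrow> z j \<in> {0..1} \<and> (\<lambda>m. Y (r m) j) \<longlonglongrightarrow> z j"
    using bounded_subsequence[of Y "n + 2", OF Y01] by blast
  have lim: "(\<lambda>m. X (r m) j) \<longlonglongrightarrow> z j" "z j \<in> {0..1}" if "j \<le> Suc n" for j
    using z[of j] that by (simp_all add: Y_def)
  have "cuts n z"
    unfolding cuts_def
  proof (intro conjI allI impI)
    have "(\<lambda>m. X (r m) 0) = (\<lambda>_. 0)" "(\<lambda>m. X (r m) (Suc n)) = (\<lambda>_. 1)"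
      using X(1) by (auto simp: cuts_def)
    with lim(1)[of 0] lim(1)[of "Suc n"] show "z 0 = 0" "z (Suc n) = 1"
      by (simp_all add: LIMSEQ_const_iff)
    fix j assume j: "j \<le> n"
    show "z j \<le> z (Suc j)"
    proof (rule LIMSEQ_le)
      show "(\<lambda>m. X (r m) j) \<longlonglongrightarrow> z j" "(\<lambda>m. X (r m) (Suc j)) \<longlonglongrightarrow> z (Suc j)"
        using lim(1) j by auto
      show "\<exists>N. \<forall>m\<ge>N. X (r m) j \<le> X (r m) (Suc j)" using X(1) j by (auto simp: cuts_def)
    qed
  qed
  moreover have "alternating_sum n z (F i) = 0" if i: "i < n" for i
  proof (rule LIMSEQ_unique)
    have "(\<lambda>m. F i (X (r m) j)) \<longlonglongrightarrow> F i (z j)" if "j \<le> Suc n" for j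
      using cuts_in_unit_interval[OF X(1) that] lim[OF that]
      by (intro continuous_on_tendsto_compose[OF cont[OF i]]) auto
    then show "(\<lambda>m. alternating_sum n (X (r m)) (F i)) \<longlonglongrightarrow> alternating_sum n z (F i)"
      unfolding alternating_sum_def by (intro tendsto_intros) auto
    show "(\<lambda>m. alternating_sum n (X (r m)) (F i)) \<longlonglongrightarrow> 0"
    proof (rule Lim_null_comparison)
      show "\<forall>\<^sub>F m in sequentially. norm (alternating_sum n (X (r m)) (F i))
          \<le> real n * F i 1 / real (Suc (r m))"
        using X(2)[OF i] by auto
      have "(\<lambda>m. real n * F i 1 / real (Suc m)) \<longlonglongrightarrow> 0"
        by (intro real_tendsto_divide_at_top[OF tendsto_const] filterlim_compose[OF filterlim_real_sequentially] filterlim_Suc)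
      from LIMSEQ_subseq_LIMSEQ[OF this r] show "(\<lambda>m. real n * F i 1 / real (Suc (r m))) \<longlonglongrightarrow> 0"
        by (simp add: o_def)
    qed
  qed
  ultimately show thesis using that by blast
qed

section \<open>Iterated bisection\<close>

definition flip :: "nat \<Rightarrow> (nat \<Rightarrow> nat) \<Rightarrow> nat \<Rightarrow> nat" where
  "flip c u = u(c := 1 - u c)"

lemma flip_cube: "u \<in> cube d \<Longrightarrow> c \<in> {1..d} \<Longrightarrow> flip c u \<in> cube d"
  by (auto simp: flip_def cube_def PiE_iff extensional_def)

lemma cube_cases: "u \<in> cube d \<Longrightarrow> k \<in> {1..d} \<Longrightarrow> u k = 0 \<or> u k = 1"
  by (auto simp: cube_def PiE_iff)

lemma flip_flip: "u \<in> cube d \<Longrightarrow> c \<in> {1..d} \<Longrightarrow> flip c (flip c u) = u"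
  using cube_cases[of u d c] by (auto simp: flip_def)

lemma adjacent_flip: "u \<in> cube d \<Longrightarrow> c \<in> {1..d} \<Longrightarrow> cube_adjacent d u (flip c u)"
proof -
  assume u: "u \<in> cube d" "c \<in> {1..d}"
  then have "{k \<in> {1..d}. u k \<noteq> flip c u k} = {c}"
    using cube_cases[of u d c] by (auto simp: flip_def)
  with u show ?thesis by (simp add: cube_adjacent_def flip_cube)
qed

text \<open>The same flip at both ends leaves the set of differing coordinates unchanged. A new cut
  flips everything to its right, so the old cuts there stay admissible.\<close>

lemma adjacent_flip_flip:
  assumes "cube_adjacent d u v" "c \<in> {1..d}" shows "cube_adjacent d (flip c u) (flip c v)"
proof -
  have uv: "u \<in> cube d" "v \<in> cube d" using assms(1) by (auto simp: cube_adjacent_def)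
  have "{k \<in> {1..d}. flip c u k \<noteq> flip c v k} = {k \<in> {1..d}. u k \<noteq> v k}"
    using cube_cases[OF uv(1) assms(2)] cube_cases[OF uv(2) assms(2)] by (auto simp: flip_def)
  with assms uv show ?thesis by (simp add: cube_adjacent_def flip_cube)
qed

text \<open>\<open>f\<close> labels pieces, while \<open>g\<close> is a function of the point whose
  level sets can be bisected. They are compared only inside the pieces: a cut point belongs to
  several pieces, and degenerate pieces impose nothing on \<open>g\<close>.\<close>

definition represents ::
  "nat \<Rightarrow> nat \<Rightarrow> (nat \<Rightarrow> real) \<Rightarrow> (nat \<Rightarrow> nat \<Rightarrow> nat) \<Rightarrow> (real \<Rightarrow> nat \<Rightarrow> nat) \<Rightarrow> bool" where
  "represents d N x f g \<longleftrightarrow> partition_allocation d N x f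
     \<and> (\<forall>i\<in>{1..N}. f i = f (i + 1) \<or> cube_adjacent d (f i) (f (i + 1)))
     \<and> (\<forall>j\<in>{1..N + 1}. \<forall>y. x (j - 1) < y \<longrightarrow> y < x j \<longrightarrow> g y = f j)"

lemma partition_mono:
  assumes "partition_allocation d N x f" "i \<le> j" "j \<le> N + 1" shows "x i \<le> x j"
  using assms(2,3)
proof (induction j rule: dec_induct)
  case (step j)
  then have "x i \<le> x j" "x j \<le> x (Suc j)" using assms(1) by (simp_all add: partition_allocation_def)
  then show ?case by (rule order_trans)
qed auto

lemma partition_locate:
  assumes "partition_allocation d N x f" "z \<in> {0..1}"
  obtains j where "j \<in> {1..N + 1}" "x (j - 1) \<le> z" "z \<le> x j"
proof -
  have x: "x 0 = 0" "x (N + 1) = 1" using assms(1) by (auto simp: partition_allocation_def)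
  define j where "j = (LEAST j. z \<le> x j)"
  have ex: "z \<le> x (N + 1)" using assms(2) x by simp
  then have "z \<le> x j" unfolding j_def by (rule LeastI)
  moreover have "j \<le> N + 1" unfolding j_def using ex by (rule Least_le)
  moreover have "x (j - 1) \<le> z" if "j \<noteq> 0"
  proof -
    have "\<not> z \<le> x (j - 1)" using not_less_Least[of "j - 1" "\<lambda>j. z \<le> x j"] that by (simp add: j_def)
    then show ?thesis by simp
  qed
  \<comment> \<open>For \<open>z = 0\<close> the least index is 0, which is no piece; the first
    piece serves instead.\<close>
  moreover have "z \<le> x 1" "x 0 \<le> z" if "j = 0"
    using \<open>z \<le> x j\<close> that partition_mono[OF assms(1), of 0 1] x assms(2) by auto
  ultimately show thesis using that[of j] that[of 1] by (cases "j = 0") auto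
qed

text \<open>Cutting piece \<open>j\<close> at \<open>z\<close> duplicates it, and \<open>c\<close>
  is flipped on the right copy and on all later pieces. If \<open>z\<close> is an old cut, one copy
  is degenerate; it still separates the two cuts, so that each of them changes at most one
  coordinate.\<close>

lemma represents_insert:
  assumes rep: "represents d N x f g" and z: "z \<in> {0..1}" and c: "c \<in> {1..d}"
  shows "\<exists>x' f'. represents d (Suc N) x' f' (\<lambda>y. if z < y then flip c (g y) else g y)"
proof -
  have pa: "partition_allocation d N x f" using rep by (simp add: represents_def)
  have x: "x 0 = 0" "x (N + 1) = 1" using pa by (auto simp: partition_allocation_def)
  have f: "f i \<in> cube d" if "i \<in> {1..N + 1}" for i
    using pa that by (auto simp: partition_allocation_def)
  obtain j where j: "j \<in> {1..N + 1}" "x (j - 1) \<le> z" "z \<le> x j"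
    using partition_locate[OF pa z] .
  define x' where "x' i = (if i < j then x i else if i = j then z else x (i - 1))" for i
  define f' where "f' i = (if i \<le> j then f i else flip c (f (i - 1)))" for i
  have mono: "x' i \<le> x' (i + 1)" if "i \<le> N + 1" for i
  proof -
    consider "i + 1 < j" | "i + 1 = j" | "i = j" | "i > j" by linarith
    then show ?thesis
    proof cases
      case 1
      then show ?thesis using partition_mono[OF pa, of i "i + 1"] j by (simp add: x'_def)
    next
      case 2
      then show ?thesis using j by (auto simp: x'_def)
    next
      case 3
      then show ?thesis using j by (simp add: x'_def)
    next
      case 4
      then show ?thesis using partition_mono[OF pa, of "i - 1" i] that by (simp add: x'_def)
    qed
  qed
  have f'_cube: "f' i \<in> cube d" if "i \<in> {1..Suc N + 1}" for i
  proof (cases "i \<le> j")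
    case True
    then show ?thesis using f[of i] that j by (simp add: f'_def)
  next
    case False
    then have "i - 1 \<in> {1..N + 1}" using that j by auto
    with False show ?thesis using flip_cube[OF f c] by (simp add: f'_def)
  qed
  have adj: "f' i = f' (i + 1) \<or> cube_adjacent d (f' i) (f' (i + 1))" if i: "i \<in> {1..Suc N}" for i
  proof -
    have f_adj: "f k = f (k + 1) \<or> cube_adjacent d (f k) (f (k + 1))" if "k \<in> {1..N}" for k
      using rep that by (simp add: represents_def)
    consider "i < j" | "i = j" | "i > j" by linarith
    then show ?thesis
    proof cases
      case 1
      then show ?thesis using f_adj[of i] i j by (simp add: f'_def)
    next
      case 2
      then show ?thesis using adjacent_flip[OF f[OF j(1)] c] by (simp add: f'_def)
    next
      case 3
      have "i - 1 \<in> {1..N}" "i - 1 + 1 = i" using 3 i j by auto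
      then have "f (i - 1) = f i \<or> cube_adjacent d (f (i - 1)) (f i)" using f_adj[of "i - 1"] by simp
      then show ?thesis using adjacent_flip_flip[OF _ c] 3 by (auto simp: f'_def)
    qed
  qed
  have val: "(if z < y then flip c (g y) else g y) = f' i"
    if i: "i \<in> {1..Suc N + 1}" and y: "x' (i - 1) < y" "y < x' i" for i y
  proof -
    have g: "g y = f k" if "k \<in> {1..N + 1}" "x (k - 1) < y" "y < x k" for k
      using rep that by (simp add: represents_def)
    consider "i < j" | "i = j" | "i = j + 1" | "i > j + 1" by linarith
    then show ?thesis
    proof cases
      case 1
      then have "y < x i" "x (i - 1) < y" using y by (auto simp: x'_def split: if_splits)
      moreover have "x i \<le> x (j - 1)" using partition_mono[OF pa, of i "j - 1"] 1 j by auto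
      then have "y < z" using \<open>y < x i\<close> j(2) by linarith
      ultimately show ?thesis using g[of i] 1 i j by (simp add: f'_def)
    next
      case 2
      then have "x (j - 1) < y" "y < z" using y j by (auto simp: x'_def)
      then show ?thesis using g[of j] 2 j by (simp add: f'_def)
    next
      case 3
      then have "z < y" "y < x j" using y by (auto simp: x'_def)
      then show ?thesis using g[of j] 3 j by (simp add: f'_def)
    next
      case 4
      then have "\<not> i - 1 < j" "i - 1 \<noteq> j" "\<not> i < j" "i \<noteq> j" by auto
      then have *: "x (i - 1 - 1) < y" "y < x (i - 1)" using y unfolding x'_def by simp_all
      moreover have "x j \<le> x (i - 1 - 1)" using partition_mono[OF pa, of j "i - 1 - 1"] 4 i by auto
      ultimately have "z < y" using j by linarith
      moreover have "i - 1 \<in> {1..N + 1}" using 4 i by auto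
      ultimately show ?thesis using * g[of "i - 1"] 4 by (simp add: f'_def)
    qed
  qed
  have "x' 0 = 0" "x' (Suc N + 1) = 1" using j x by (auto simp: x'_def)
  then have "partition_allocation d (Suc N) x' f'"
    unfolding partition_allocation_def using mono f'_cube by auto
  then have "represents d (Suc N) x' f' (\<lambda>y. if z < y then flip c (g y) else g y)"
    unfolding represents_def using adj val by blast
  then show ?thesis by blast
qed

section \<open>Parity of the number of cuts before a point\<close>

definition cuts_before :: "nat \<Rightarrow> (nat \<Rightarrow> real) \<Rightarrow> real \<Rightarrow> nat" where
  "cuts_before m z y = card {i \<in> {1..m}. z i < y}"

lemma cuts_before_Suc: "cuts_before (Suc m) z y = cuts_before m z y + (if z (Suc m) < y then 1 else 0)"
proof -
  have "{i \<in> {1..Suc m}. z i < y} = {i \<in> {1..m}. z i < y} \<union> (if z (Suc m) < y then {Suc m} else {})"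
    by (auto simp: le_Suc_eq)
  then show ?thesis by (auto simp: cuts_before_def)
qed

lemma represents_insert_many:
  assumes rep: "represents d N x f g" and z: "\<And>i. i \<in> {1..m} \<Longrightarrow> z i \<in> {0..1}" and c: "c \<in> {1..d}"
  shows "\<exists>x' f'. represents d (N + m) x' f' (\<lambda>y. (flip c ^^ cuts_before m z y) (g y))"
  using z
proof (induction m)
  case 0
  then show ?case using rep by (auto simp: cuts_before_def)
next
  case (Suc m)
  then obtain x' f' where "represents d (N + m) x' f' (\<lambda>y. (flip c ^^ cuts_before m z y) (g y))"
    by (metis atLeastAtMost_iff le_SucI)
  from represents_insert[OF this _ c, of "z (Suc m)"] Suc.prems[of "Suc m"]
  obtain x'' f'' where "represents d (Suc (N + m)) x'' f'' (\<lambda>y. if z (Suc m) < y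
      then flip c ((flip c ^^ cuts_before m z y) (g y)) else (flip c ^^ cuts_before m z y) (g y))"
    by auto
  moreover have "(\<lambda>y. if z (Suc m) < y
      then flip c ((flip c ^^ cuts_before m z y) (g y)) else (flip c ^^ cuts_before m z y) (g y))
      = (\<lambda>y. (flip c ^^ cuts_before (Suc m) z y) (g y))"
    by (auto simp: cuts_before_Suc)
  ultimately show ?case by auto
qed

lemma cuts_before_eq:
  assumes "cuts m z" "k \<le> m" "z k < y" "y \<le> z (Suc k)"
  shows "cuts_before m z y = k"
proof -
  have "{i \<in> {1..m}. z i < y} = {1..k}"
  proof (intro equalityI subsetI)
    fix i assume i: "i \<in> {i \<in> {1..m}. z i < y}"
    then have "\<not> Suc k \<le> i" using cuts_mono[OF assms(1), of "Suc k" i] assms(4) by auto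
    with i show "i \<in> {1..k}" by auto
  next
    fix i assume i: "i \<in> {1..k}"
    then show "i \<in> {i \<in> {1..m}. z i < y}"
      using cuts_mono[OF assms(1), of i k] assms(2,3) by auto
  qed
  then show ?thesis by (simp add: cuts_before_def)
qed

lemma cuts_locate:
  assumes "cuts m z" "0 < y" "y \<le> 1"
  obtains k where "k \<le> m" "z k < y" "y \<le> z (Suc k)"
proof -
  define k where "k = (LEAST k. y \<le> z (Suc k))"
  have m: "y \<le> z (Suc m)" using assms by (simp add: cuts_def)
  have "k \<le> m" unfolding k_def using m by (rule Least_le)
  moreover have "y \<le> z (Suc k)" unfolding k_def using m by (rule LeastI)
  moreover have "z k < y"
  proof (cases k)
    case 0
    then show ?thesis using assms by (simp add: cuts_def)
  next
    case (Suc l)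
    then have "\<not> y \<le> z (Suc l)" using not_less_Least[of l "\<lambda>k. y \<le> z (Suc k)"] by (simp add: k_def)
    then show ?thesis using Suc by simp
  qed
  ultimately show thesis using that by blast
qed

text \<open>On the half-open piece \<open>{z k<..z (Suc k)}\<close> the count is constantly
  \<open>k\<close>. Such pieces are disjoint and their masses are differences of a distribution
  function; the point 0 lies in none of them.\<close>

lemma even_cuts_before:
  assumes "cuts m z"
  shows "{y \<in> {0<..1}. even (cuts_before m z y) = s}
    = (\<Union>k\<in>{k \<in> {..m}. even k = s}. {z k<..z (Suc k)})"
proof (intro equalityI subsetI)
  fix y assume y: "y \<in> {y \<in> {0<..1}. even (cuts_before m z y) = s}"
  then obtain k where "k \<le> m" "z k < y" "y \<le> z (Suc k)" using cuts_locate[OF assms] by auto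
  with y cuts_before_eq[OF assms] show "y \<in> (\<Union>k\<in>{k \<in> {..m}. even k = s}. {z k<..z (Suc k)})"
    by auto
next
  fix y assume "y \<in> (\<Union>k\<in>{k \<in> {..m}. even k = s}. {z k<..z (Suc k)})"
  then obtain k where k: "k \<le> m" "even k = s" "z k < y" "y \<le> z (Suc k)" by auto
  then have "0 \<le> z k" "z (Suc k) \<le> 1"
    using cuts_in_unit_interval[OF assms, of k] cuts_in_unit_interval[OF assms, of "Suc k"] by auto
  with k cuts_before_eq[OF assms] show "y \<in> {y \<in> {0<..1}. even (cuts_before m z y) = s}" by auto
qed

lemma sets_even_cuts_before:
  assumes "cuts m z" shows "{y \<in> {0<..1}. even (cuts_before m z y) = s} \<in> sets borel"
  unfolding even_cuts_before[OF assms] by (intro sets.finite_UN) auto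

section \<open>Restrictions of an atomless measure\<close>

locale continuous_measure =
  fixes M :: "real measure"
  assumes continuous: "continuous_prob_measure M"
begin

sublocale prob_space M using continuous by (simp add: continuous_prob_measure_def)

lemma space_M [simp]: "space M = {0..1}"
  using continuous sets_eq_imp_space_eq[of M "restrict_space borel {0..1}"]
  by (auto simp: continuous_prob_measure_def space_restrict_space)

lemma sets_M_iff: "A \<in> sets M \<longleftrightarrow> A \<subseteq> {0..1} \<and> A \<in> sets borel"
  using continuous by (simp add: continuous_prob_measure_def sets_restrict_space_iff)

lemma finite_null: "finite Z \<Longrightarrow> Z \<subseteq> {0..1} \<Longrightarrow> Z \<in> null_sets M"
proof (induction Z rule: finite_induct)
  case (insert a Z)
  then have "{a} \<in> null_sets M"
    using continuous by (auto simp: continuous_prob_measure_def null_sets_def sets_M_iff)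
  with insert have "{a} \<union> Z \<in> null_sets M" by (intro null_sets.Un) auto
  then show ?case by simp
qed auto

text \<open>The restriction of \<open>M\<close> to \<open>A\<close>, moved from the unit interval to
  the whole line so that the theory of \<open>cdf\<close> for finite Borel measures applies.\<close>

definition part :: "real set \<Rightarrow> real measure" where
  "part A = distr (density M (indicator A)) borel (\<lambda>y. y)"

lemma sets_part [simp]: "sets (part A) = sets borel" and space_part [simp]: "space (part A) = UNIV"
  by (simp_all add: part_def)

lemma emeasure_part:
  assumes "A \<in> sets M" "B \<in> sets borel"
  shows "emeasure (part A) B = emeasure M (A \<inter> B)"
proof -
  have sets: "sets M = sets (restrict_space borel {0..1})"
    using continuous by (simp add: continuous_prob_measure_def)
  have "(\<lambda>y. y) \<in> measurable (density M (indicator A)) borel"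
    using sets by (simp add: measurable_cong_sets[OF sets refl] measurable_restrict_space1)
  then have "emeasure (part A) B = emeasure (density M (indicator A)) (B \<inter> {0..1})"
    using assms unfolding part_def by (simp add: emeasure_distr vimage_def Int_def)
  also have "\<dots> = emeasure M (A \<inter> (B \<inter> {0..1}))"
    using assms by (intro emeasure_restricted) (auto simp: sets_M_iff)
  also have "A \<inter> (B \<inter> {0..1}) = A \<inter> B" using assms by (auto simp: sets_M_iff)
  finally show ?thesis .
qed

lemma measure_part:
  "A \<in> sets M \<Longrightarrow> B \<in> sets borel \<Longrightarrow> measure (part A) B = measure M (A \<inter> B)"
  by (simp add: measure_def emeasure_part)

lemma finite_borel_measure_part:
  assumes "A \<in> sets M" shows "finite_borel_measure (part A)"
proof (intro finite_borel_measure.intro finite_borel_measure_axioms.intro finite_measureI)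
  show "emeasure (part A) (space (part A)) \<noteq> \<infinity>"
    using emeasure_part[OF assms, of UNIV] by simp
qed simp

text \<open>Continuity is the absence of atoms: \<open>A\<close> meets each singleton in a null set.
  The value at 0 comes from the same fact.\<close>

lemma cdf_part:
  assumes "A \<in> sets M"
  shows "continuous_on {0..1} (cdf (part A))" "mono_on {0..1} (cdf (part A))" "cdf (part A) 0 = 0"
proof -
  interpret P: finite_borel_measure "part A" using finite_borel_measure_part[OF assms] .
  have null: "measure M (A \<inter> B) = 0" if "A \<inter> B \<subseteq> {y}" for B y
  proof (cases "A \<inter> B = {}")
    case False
    then have "A \<inter> B = {y}" "y \<in> {0..1}" using that assms by (auto simp: sets_M_iff)
    then show ?thesis using finite_null[of "{y}"] by (simp add: null_sets_def measure_def)
  qed simp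
  have "measure (part A) {y} = 0" for y using measure_part[OF assms, of "{y}"] null[of "{y}" y] by simp
  then show "continuous_on {0..1} (cdf (part A))"
    by (intro continuous_at_imp_continuous_on ballI) (simp add: P.isCont_cdf)
  show "mono_on {0..1} (cdf (part A))" by (auto simp: mono_on_def intro: P.cdf_nondecreasing)
  have "A \<inter> {..0} \<subseteq> {0}" using assms by (auto simp: sets_M_iff)
  then show "cdf (part A) 0 = 0" using null[of "{..0}" 0] measure_part[OF assms, of "{..0}"] by (simp add: cdf_def)
qed

lemma bisection:
  assumes A: "A \<in> sets M" and z: "cuts m z" and zero: "alternating_sum m z (cdf (part A)) = 0"
  shows "{y \<in> A. even (cuts_before m z y) = s} \<in> sets M"
    and "measure M {y \<in> A. even (cuts_before m z y) = s} = measure M A / 2"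
proof -
  interpret P: finite_borel_measure "part A" using finite_borel_measure_part[OF A] .
  define E where "E s = {y \<in> {0<..1}. even (cuts_before m z y) = s}" for s
  define I where "I k = {z k<..z (Suc k)}" for k
  have E_sets: "E s \<in> sets borel" for s unfolding E_def using sets_even_cuts_before[OF z] .
  have disj: "disjoint_family_on I {..m}"
    unfolding disjoint_family_on_def
  proof (intro ballI impI equals0I)
    fix k l y assume *: "k \<in> {..m}" "l \<in> {..m}" "k \<noteq> l" "y \<in> I k \<inter> I l"
    then have "cuts_before m z y = k" "cuts_before m z y = l"
      by (auto simp: I_def intro!: cuts_before_eq[OF z])
    with * show False by simp
  qed
  have E_sum: "measure (part A) (E s) = (\<Sum>k | k \<in> {..m} \<and> even k = s. measure (part A) (I k))" for s
  proof -
    have "disjoint_family_on I {k. k \<in> {..m} \<and> even k = s}"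
      by (rule disjoint_family_on_mono[OF _ disj]) auto
    then show ?thesis
      unfolding E_def even_cuts_before[OF z] I_def[symmetric]
      by (intro P.finite_measure_finite_Union) (simp_all add: image_subset_iff, simp add: I_def)
  qed
  have I_cdf: "cdf (part A) (z (Suc k)) - cdf (part A) (z k) = measure (part A) (I k)" if "k \<le> m" for k
    using P.cdf_diff_eq[of "z k" "z (Suc k)"] z that
    by (cases "z k = z (Suc k)") (auto simp: I_def cuts_def less_le)
  have split: "(\<Sum>k\<le>m. h k) = (\<Sum>k | k \<in> {..m} \<and> even k = True. h k) + (\<Sum>k | k \<in> {..m} \<and> even k = False. h k)"
    for h :: "nat \<Rightarrow> real"
    by (subst sum.union_disjoint[symmetric]) (auto intro!: sum.cong)
  have "alternating_sum m z (cdf (part A)) = (\<Sum>k\<le>m. (- 1) ^ k * measure (part A) (I k))"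
    unfolding alternating_sum_def using I_cdf by (intro sum.cong) auto
  also have "\<dots> = measure (part A) (E True) - measure (part A) (E False)"
    unfolding split E_sum sum_negf[symmetric] diff_conv_add_uminus
    by (intro arg_cong2[where f = "(+)"] sum.cong) auto
  finally have diff: "measure (part A) (E True) = measure (part A) (E False)" using zero by simp
  have A01: "A \<subseteq> {0..1}" using A by (simp add: sets_M_iff)
  have AE_sets: "A \<inter> E s \<in> sets M" for s using A E_sets by (auto simp: sets_M_iff)
  \<comment> \<open>The point 0 can lie in \<open>A\<close> although no half-open piece contains it;
    it is split off as a null set.\<close>
  have eq: "{y \<in> A. even (cuts_before m z y) = s} = A \<inter> E s \<union> {y \<in> A \<inter> {0}. even (cuts_before m z y) = s}" for s
    using A01 by (auto simp: E_def)
  have null: "{y \<in> A \<inter> {0}. even (cuts_before m z y) = s} \<in> null_sets M" for s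
    by (rule finite_null) (use A01 in \<open>auto intro: finite_subset[of _ "{0}"]\<close>)
  have 1: "{y \<in> A. even (cuts_before m z y) = s} \<in> sets M"
      "measure M {y \<in> A. even (cuts_before m z y) = s} = measure (part A) (E s)" for s
    unfolding eq
    using sets.Un[OF AE_sets null_setsD2[OF null]] measure_Un_null_set[OF AE_sets null]
      measure_part[OF A E_sets] by simp_all
  have "A = {y \<in> A. even (cuts_before m z y) = True} \<union> {y \<in> A. even (cuts_before m z y) = False}" by auto
  then have "measure M A = measure M {y \<in> A. even (cuts_before m z y) = True}
      + measure M {y \<in> A. even (cuts_before m z y) = False}"
    using finite_measure_Union[OF 1(1)[of True] 1(1)[of False]] by auto
  then have "measure M A = measure (part A) (E True) + measure (part A) (E False)"
    unfolding 1(2) .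
  then show "measure M {y \<in> A. even (cuts_before m z y) = s} = measure M A / 2"
    unfolding 1(2) using diff by (cases s) auto
  show "{y \<in> A. even (cuts_before m z y) = s} \<in> sets M" using 1(1) .
qed

text \<open>Closed pieces overlap in their ends, and \<open>g\<close> is arbitrary there. All ends
  together form a finite, hence null, set; away from it the pieces of \<open>t\<close> fill exactly
  the level set of \<open>g\<close>.\<close>

lemma measure_represents:
  assumes rep: "represents d N x f g" and g: "{y \<in> {0..1}. g y = t} \<in> sets M"
  shows "measure M (\<Union>j\<in>{j \<in> {1..N + 1}. f j = t}. piece x j) = measure M {y \<in> {0..1}. g y = t}"
proof -
  have pa: "partition_allocation d N x f" using rep by (simp add: represents_def)
  have x01: "x i \<in> {0..1}" if "i \<le> N + 1" for i
    using partition_mono[OF pa, of 0 i] partition_mono[OF pa, of i "N + 1"] that pa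
    by (simp add: partition_allocation_def)
  define Z where "Z = x ` {0..N + 1}"
  have Z: "Z \<in> null_sets M" using x01 by (intro finite_null) (auto simp: Z_def)
  let ?U = "\<Union>j\<in>{j \<in> {1..N + 1}. f j = t}. piece x j"
  let ?G = "{y \<in> {0..1}. g y = t}"
  have piece01: "piece x j \<subseteq> {0..1}" if "j \<in> {1..N + 1}" for j
    using x01[of j] x01[of "j - 1"] that by (auto simp: piece_def)
  have U: "?U \<in> sets M"
    using piece01 by (intro sets.finite_UN) (auto simp: sets_M_iff piece_def)
  have gval: "g y = f j" if "j \<in> {1..N + 1}" "y \<in> piece x j" "y \<notin> Z" for j y
  proof -
    have "y \<noteq> x (j - 1)" "y \<noteq> x j" using that by (auto simp: Z_def)
    with that(2) have "x (j - 1) < y" "y < x j" by (auto simp: piece_def)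
    with rep that(1) show ?thesis unfolding represents_def by blast
  qed
  have "?U \<union> Z = ?G \<union> Z"
  proof (intro equalityI subsetI)
    fix y assume y: "y \<in> ?U \<union> Z"
    show "y \<in> ?G \<union> Z"
    proof (cases "y \<in> Z")
      case False
      with y obtain j where j: "j \<in> {1..N + 1}" "f j = t" "y \<in> piece x j" by blast
      with gval[OF j(1,3) False] piece01[OF j(1)] show ?thesis by blast
    qed simp
  next
    fix y assume y: "y \<in> ?G \<union> Z"
    show "y \<in> ?U \<union> Z"
    proof (cases "y \<in> Z")
      case False
      with y have y': "y \<in> {0..1}" "g y = t" by auto
      obtain j where j: "j \<in> {1..N + 1}" "x (j - 1) \<le> y" "y \<le> x j"
        using partition_locate[OF pa y'(1)] .
      then have "y \<in> piece x j" by (simp add: piece_def)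
      moreover have "f j = t" using gval[OF j(1) calculation False] y'(2) by simp
      ultimately have "y \<in> ?U" using j(1) by (intro UN_I[of j]) auto
      then show ?thesis ..
    qed simp
  qed
  then show ?thesis using measure_Un_null_set[OF U Z] measure_Un_null_set[OF g Z] by simp
qed

end

section \<open>The stages of the iteration\<close>

lemma fun_upd_eq_iff: "u(a := b) = v \<longleftrightarrow> (\<forall>k. k \<noteq> a \<longrightarrow> u k = v k) \<and> b = v a"
  by (auto simp: fun_eq_iff)

lemma eq_fun_upd_iff: "u a = b \<Longrightarrow> u = v(a := b) \<longleftrightarrow> (\<forall>k. k \<noteq> a \<longrightarrow> u k = v k)"
  by (auto simp: fun_eq_iff)

text \<open>The vertices in use after \<open>c\<close> stages. Later coordinates are fixed at 0, so
  every value is already a vertex of the full cube and adjacency has its final meaning at every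
  stage.\<close>

definition subcube :: "nat \<Rightarrow> nat \<Rightarrow> (nat \<Rightarrow> nat) set" where
  "subcube d c = (\<Pi>\<^sub>E k\<in>{1..d}. if k \<le> c then {0, 1} else {0})"

lemma finite_subcube: "finite (subcube d c)"
  unfolding subcube_def by (intro finite_PiE) auto

lemma card_subcube:
  assumes "c \<le> d" shows "card (subcube d c) = 2 ^ c"
proof -
  have "card (subcube d c) = (\<Prod>k\<in>{1..d}. if k \<le> c then 2 else 1)"
    unfolding subcube_def by (subst card_PiE) (auto intro!: prod.cong)
  also have "\<dots> = (\<Prod>k\<in>{1..d} \<inter> {k. k \<le> c}. 2)"
    by (subst prod.If_cases) auto
  also have "{1..d} \<inter> {k. k \<le> c} = {1..c}" using assms by auto
  finally show ?thesis by simp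
qed

lemma subcube_full: "subcube d d = cube d"
  unfolding subcube_def cube_def by (intro PiE_cong) auto

lemma subcube_subset: "subcube d c \<subseteq> cube d"
  unfolding subcube_def cube_def by (intro PiE_mono) auto

lemma subcube_Suc_iff:
  assumes "Suc c \<le> d"
  shows "t \<in> subcube d (Suc c) \<longleftrightarrow> t (Suc c) \<in> {0, 1} \<and> t(Suc c := 0) \<in> subcube d c"
proof
  assume "t \<in> subcube d (Suc c)"
  then have e: "\<And>k. k \<in> {1..d} \<Longrightarrow> t k \<in> (if k \<le> Suc c then {0, 1} else {0})"
    "\<And>k. k \<notin> {1..d} \<Longrightarrow> t k = undefined"
    unfolding subcube_def PiE_iff extensional_def by blast+
  have "t(Suc c := 0) \<in> subcube d c"
    unfolding subcube_def PiE_iff extensional_def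
  proof (intro conjI ballI CollectI allI impI)
    fix k assume "k \<in> {1..d}"
    then show "(t(Suc c := 0)) k \<in> (if k \<le> c then {0, 1} else {0})"
      using e(1)[of k] by (cases "k = Suc c") (auto split: if_splits)
  next
    fix k assume "k \<notin> {1..d}"
    then show "(t(Suc c := 0)) k = undefined" using e(2)[of k] assms by (cases "k = Suc c") auto
  qed
  moreover have "t (Suc c) \<in> {0, 1}" using e(1)[of "Suc c"] assms by simp
  ultimately show "t (Suc c) \<in> {0, 1} \<and> t(Suc c := 0) \<in> subcube d c" by blast
next
  assume r: "t (Suc c) \<in> {0, 1} \<and> t(Suc c := 0) \<in> subcube d c"
  then have e: "\<And>k. k \<in> {1..d} \<Longrightarrow> (t(Suc c := 0)) k \<in> (if k \<le> c then {0, 1} else {0})"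
    "\<And>k. k \<notin> {1..d} \<Longrightarrow> (t(Suc c := 0)) k = undefined"
    unfolding subcube_def PiE_iff extensional_def by blast+
  show "t \<in> subcube d (Suc c)"
    unfolding subcube_def PiE_iff extensional_def
  proof (intro conjI ballI CollectI allI impI)
    fix k assume "k \<in> {1..d}"
    then show "t k \<in> (if k \<le> Suc c then {0, 1} else {0})"
      using e(1)[of k] r by (cases "k = Suc c") (auto split: if_splits)
  next
    fix k assume "k \<notin> {1..d}"
    then show "t k = undefined" using e(2)[of k] assms by (cases "k = Suc c") auto
  qed
qed

text \<open>The cuts add up as \<open>(2 ^ c - 1) * n + 2 ^ c * n = (2 ^ Suc c - 1) * n\<close>.
  Level sets must be measurable for the next restriction, and the range of \<open>g\<close>
  guarantees that the next coordinate is still 0.\<close>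

lemma iterated_bisection:
  assumes \<mu>: "\<And>\<kappa>. \<kappa> \<in> {1..n} \<Longrightarrow> continuous_prob_measure (\<mu> \<kappa>)" and "c \<le> d"
  shows "\<exists>x f g. represents d ((2 ^ c - 1) * n) x f g \<and> range g \<subseteq> subcube d c
    \<and> (\<forall>\<kappa>\<in>{1..n}. \<forall>t\<in>subcube d c. {y \<in> {0..1}. g y = t} \<in> sets (\<mu> \<kappa>)
        \<and> measure (\<mu> \<kappa>) {y \<in> {0..1}. g y = t} = 1 / 2 ^ c)"
  using assms(2)
proof (induction c)
  case 0
  define t0 where "t0 = (\<lambda>k\<in>{1..d}. 0 :: nat)"
  have sub: "subcube d 0 = {t0}"
  proof -
    have "subcube d 0 = (\<Pi>\<^sub>E k\<in>{1..d}. {0})" unfolding subcube_def by (intro PiE_cong) auto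
    then show ?thesis unfolding t0_def by (simp add: PiE_singleton restrict_def extensional_def)
  qed
  have t0: "t0 \<in> cube d" using sub subcube_subset by blast
  \<comment> \<open>Without cuts only the indices 0 and 1 matter, where \<open>real\<close> gives
    the required ends 0 and 1.\<close>
  have "represents d 0 (\<lambda>i. real i) (\<lambda>_. t0) (\<lambda>_. t0)"
    unfolding represents_def partition_allocation_def using t0 by auto
  moreover have "{0..1} \<in> sets (\<mu> \<kappa>) \<and> measure (\<mu> \<kappa>) {0..1} = 1" if "\<kappa> \<in> {1..n}" for \<kappa>
  proof -
    interpret continuous_measure "\<mu> \<kappa>" using \<mu>[OF that] by unfold_locales
    show ?thesis using prob_space sets.top[of "\<mu> \<kappa>"] by simp
  qed
  moreover have "{y \<in> {0..1 :: real}. t0 = t} = {0..1}" if "t \<in> subcube d 0" for t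
    using that sub by auto
  ultimately show ?case
    using sub by (intro exI[of _ "\<lambda>i. real i"] exI[of _ "\<lambda>_. t0"] conjI ballI) simp_all
next
  case (Suc c)
  from Suc.IH[OF Suc_leD[OF Suc.prems]]
  obtain x f g where rep: "represents d ((2 ^ c - 1) * n) x f g"
    and g: "range g \<subseteq> subcube d c"
    and meas: "\<forall>\<kappa>\<in>{1..n}. \<forall>t\<in>subcube d c. {y \<in> {0..1}. g y = t} \<in> sets (\<mu> \<kappa>)
        \<and> measure (\<mu> \<kappa>) {y \<in> {0..1}. g y = t} = 1 / 2 ^ c"
    by (elim exE conjE) (rule that)
  have cd: "Suc c \<in> {1..d}" using Suc.prems by simp
  define A where "A t = {y \<in> {0..1}. g y = t}" for t
  define m where "m = 2 ^ c * n"
  have "card ({1..n} \<times> subcube d c) = m"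
    using card_subcube[of c d] Suc.prems by (simp add: card_cartesian_product m_def)
  \<comment> \<open>One function for each measure and each vertex in use; the numbering feeds all of
    them to \<open>Hobby_Rice\<close> at once.\<close>
  then obtain b where b: "bij_betw b {..<m} ({1..n} \<times> subcube d c)"
    using ex_bij_betw_nat_finite[of "{1..n} \<times> subcube d c"] finite_subcube
    by (auto simp: atLeast0LessThan)
  have bI: "fst (b i) \<in> {1..n}" "snd (b i) \<in> subcube d c" if "i < m" for i
    using bij_betwE[OF b] that by (auto simp: mem_Times_iff)
  define F where "F i = cdf (continuous_measure.part (\<mu> (fst (b i))) (A (snd (b i))))" for i
  have F: "continuous_on {0..1} (F i) \<and> mono_on {0..1} (F i) \<and> F i 0 = 0" if "i < m" for i
  proof -
    interpret continuous_measure "\<mu> (fst (b i))" using \<mu> bI[OF that] by unfold_locales auto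
    show ?thesis using cdf_part[of "A (snd (b i))"] meas bI[OF that] by (simp add: F_def A_def)
  qed
  obtain z where z: "cuts m z" "\<And>i. i < m \<Longrightarrow> alternating_sum m z (F i) = 0"
    using Hobby_Rice[of m F] F by blast
  define h where "h = cuts_before m z"
  define g' where "g' y = (flip (Suc c) ^^ h y) (g y)" for y
  have "z i \<in> {0..1}" if "i \<in> {1..m}" for i using cuts_in_unit_interval[OF z(1)] that by auto
  then obtain x' f' where "represents d ((2 ^ c - 1) * n + m) x' f' g'"
    using represents_insert_many[OF rep _ cd] unfolding g'_def h_def by blast
  moreover have "(2 ^ c - 1) * n + m = (2 ^ Suc c - 1) * n"
    by (simp add: m_def algebra_simps)
  ultimately have rep': "represents d ((2 ^ Suc c - 1) * n) x' f' g'" by simp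
  have g_sub: "g y \<in> subcube d c" for y using g by auto
  have g_c: "g y (Suc c) = 0" for y
    using PiE_mem[OF g_sub[of y, unfolded subcube_def] cd] by simp
  have flips: "(flip (Suc c) ^^ k) u = (if even k then u else flip (Suc c) u)" if "u \<in> cube d" for k u
    using that by (induction k) (simp_all add: flip_flip[OF _ cd])
  \<comment> \<open>Coordinate \<open>Suc c\<close> was 0, so after \<open>h y\<close> flips it is
    the parity of \<open>h y\<close>.\<close>
  have g': "g' y = (g y)(Suc c := of_bool (odd (h y)))" for y
    unfolding g'_def flips[OF subsetD[OF subcube_subset g_sub]] flip_def
    by (simp add: g_c fun_upd_idem)
  have "g' y \<in> subcube d (Suc c)" for y
    unfolding subcube_Suc_iff[OF Suc.prems] g'
    using g_sub[of y] fun_upd_idem[of "g y" "Suc c" 0, OF g_c] by simp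
  moreover have "{y \<in> {0..1}. g' y = t} \<in> sets (\<mu> \<kappa>)
      \<and> measure (\<mu> \<kappa>) {y \<in> {0..1}. g' y = t} = 1 / 2 ^ Suc c"
    if \<kappa>: "\<kappa> \<in> {1..n}" and t: "t \<in> subcube d (Suc c)" for \<kappa> t
  proof -
    interpret continuous_measure "\<mu> \<kappa>" using \<mu>[OF \<kappa>] by unfold_locales
    define u where "u = t(Suc c := 0)"
    have u: "u \<in> subcube d c" and tc: "t (Suc c) = 0 \<or> t (Suc c) = 1"
      using t subcube_Suc_iff[OF Suc.prems] by (auto simp: u_def)
    have "(\<kappa>, u) \<in> b ` {..<m}" using b \<kappa> u by (simp add: bij_betw_def)
    then obtain i where i: "i < m" "b i = (\<kappa>, u)" by (elim imageE) auto
    \<comment> \<open>Thief \<open>t\<close> owns, within the region of its predecessor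
      \<open>u\<close>, the points with one parity of \<open>h\<close>.\<close>
    have "g' y = t \<longleftrightarrow> g y = u \<and> even (h y) = (t (Suc c) = 0)" for y
    proof -
      have "g' y = t \<longleftrightarrow> (\<forall>k. k \<noteq> Suc c \<longrightarrow> g y k = t k) \<and> of_bool (odd (h y)) = t (Suc c)"
        unfolding g' by (rule fun_upd_eq_iff)
      moreover have "g y = u \<longleftrightarrow> (\<forall>k. k \<noteq> Suc c \<longrightarrow> g y k = t k)"
        unfolding u_def using g_c by (rule eq_fun_upd_iff)
      ultimately show ?thesis using tc by auto
    qed
    then have eq: "{y \<in> {0..1}. g' y = t} = {y \<in> A u. even (cuts_before m z y) = (t (Suc c) = 0)}"
      by (auto simp: A_def h_def)
    have Au: "A u \<in> sets (\<mu> \<kappa>)" "measure (\<mu> \<kappa>) (A u) = 1 / 2 ^ c"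
      using meas \<kappa> u by (simp_all add: A_def)
    have "alternating_sum m z (cdf (part (A u))) = 0" using z(2)[OF i(1)] i(2) by (simp add: F_def)
    from bisection[OF Au(1) z(1) this, of "t (Suc c) = 0"] Au(2)
    show ?thesis unfolding eq by simp
  qed
  ultimately show ?case using rep' by (intro exI[of _ x'] exI[of _ f'] exI[of _ g']) auto
qed

theorem theorem5p9:
  fixes d r n :: nat and \<mu> :: "nat \<Rightarrow> real measure"
  assumes "d \<ge> 1"
    and "r = 2 ^ d"
    and "\<And>\<kappa>. \<kappa> \<in> {1..n} \<Longrightarrow> continuous_prob_measure (\<mu> \<kappa>)"
  shows "\<exists>x f. binary_necklace_splitting d n ((r - 1) * n) \<mu> x f"
proof -
  from iterated_bisection[where c = d and d = d and n = n and \<mu> = \<mu>, OF _ order.refl] assms(3)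
  have "\<exists>x f g. represents d ((2 ^ d - 1) * n) x f g \<and> range g \<subseteq> cube d
    \<and> (\<forall>\<kappa>\<in>{1..n}. \<forall>t\<in>cube d. {y \<in> {0..1}. g y = t} \<in> sets (\<mu> \<kappa>)
        \<and> measure (\<mu> \<kappa>) {y \<in> {0..1}. g y = t} = 1 / 2 ^ d)"
    unfolding subcube_full by blast
  then obtain x f g where rep: "represents d ((2 ^ d - 1) * n) x f g"
    and g: "\<forall>\<kappa>\<in>{1..n}. \<forall>t\<in>cube d. {y \<in> {0..1}. g y = t} \<in> sets (\<mu> \<kappa>)
        \<and> measure (\<mu> \<kappa>) {y \<in> {0..1}. g y = t} = 1 / 2 ^ d"
    by (elim exE conjE) (rule that)
  have "fair d n ((2 ^ d - 1) * n) \<mu> x f"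
    unfolding fair_def
  proof (intro ballI)
    fix \<kappa> t assume kt: "\<kappa> \<in> {1..n}" "t \<in> cube d"
    interpret continuous_measure "\<mu> \<kappa>" using assms(3)[OF kt(1)] by unfold_locales
    show "measure (\<mu> \<kappa>) (\<Union>j\<in>{j \<in> {1..(2 ^ d - 1) * n + 1}. f j = t}. piece x j) = 1 / 2 ^ d"
      using measure_represents[OF rep] g kt by simp
  qed
  with rep show ?thesis
    unfolding binary_necklace_splitting_def represents_def assms(2) by blast
qed

end
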